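(* Restrict $F_{ang}$ to the subset $\Xi_{\mathcal W,0}/V_T$ of $\Xi_{\mathcal W}/V_T$ on which the Hamiltonian vanishes. On that subset, the fixed point $q_{out}\in\Xi_{\mathcal W,0}/V_T$ is an asymptotically stable equilibrium, and the fixed point $q_{in}$ is unstable.
   Context: Let $\zeta=\exp(2\pi i/3)$, $V_T=\{1,\zeta,\zeta^2\}$, and $\mathrm{Re}(a,b):=\mathrm{Re}(\bar ab)$ for $a,b\in\mathbb C$. The Fuller system with triangular control is $z_3'=z_2$, $z_2'=z_1$, $z_1'=-iu$, $u(t)\in V_T$, with Hamiltonian $\mathcal H_F(z,u)=\mathrm{Re}(z_1,iz_2)+\mathrm{Re}(u,z_3)$; the control maximizes $\mathcal H_F(z(t),\cdot)$ over $V_T$. The Hamiltonian vanishes at $z$ if $\max_{u\in V_T}\mathcal H_F(z,u)=0$. Walls: $\mathcal W=\mathbb R_{\le0}\cup\mathbb R_{\le0}\zeta\cup\mathbb R_{\le0}\zeta^2$. For $z^0\in\mathbb C^3\setminus\{0\}$ with $z_3^0\in\mathcal W$, the first control $u$ is the element of $V_T$ whose vector $(\mathrm{Re}(z_3^0,u),\mathrm{Re}(z_2^0,u),\mathrm{Re}(z_1^0,u))$ is lexicographically maximal; if two elements $\zeta^i,\zeta^{i+1}$ tie, it is $\zeta^i$. Let $z(t)$ be the solution with $z(0)=z^0$ and constant control $u$; the first positive switching time $t_{sw}$ is the least $t>0$ at which $\mathrm{Re}(u-u',z_3(t))=0$ for some $u'\in V_T\setminus\{u\}$; the Fuller–Poincaré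 map is $F(z^0)=z(t_{sw})$. Let $\phi(z)=(|z_1|^6+|z_2|^3+|z_3|^2)^{1/6}$, $\Xi=\{\xi\in\mathbb C^3:\phi(\xi)=1\}$, $\Xi_{\mathcal W}=\{\xi\in\Xi:\xi_3\in\mathcal W\}$, and $\Xi_{\mathcal W,0}$ the subset of $\Xi_{\mathcal W}$ where the Hamiltonian vanishes. Each $z\neq0$ is uniquely $(r\xi_1,r^2\xi_2,r^3\xi_3)$ with $r>0$, $\xi\in\Xi$ (its angular component). $F_{ang}:\Xi_{\mathcal W}/V_T\to\Xi_{\mathcal W}/V_T$ sends $\xi$ to the angular component of $F(\xi)$, modulo the diagonal action of $V_T$; it preserves $\Xi_{\mathcal W,0}/V_T$. $q_{out}$ is the fixed point of $F_{ang}$ given by the angular component (mod $V_T$) of $$\Big(-1+i\tfrac{-1+r}{\sqrt3(1+r)},\ -\tfrac{-1+r^3}{\sqrt3(1+r^3)}+i\tfrac{1-3r-2r^2-3r^3+r^4}{3(1+r+r^3+r^4)},\ \tfrac{-2(1+r-4r^3-7r^4-9r^5-7r^6-4r^7+r^9+r^{10})}{9(1+r)^2(1-r+r^2)(1+r^3+r^6)}\Big),$$ where $r\approx6.27$ is the unique real root $>1$ of $1-5r-7r^2-5r^3-7r^4-5r^5+r^6$; and $q_{in}=\tau(q_{out})$ with $\tau(z_1,z_2,z_3)=(\bar z_1,-\bar z_2,\bar z_3)$. *)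

theory Defs
  imports "HOL-Analysis.Analysis"
begin

type_synonym complex3 = "complex \<times> complex \<times> complex"

definition zeta :: complex where
  "zeta = exp (2 * complex_of_real pi * \<i> / 3)"

definition V_T :: "complex set" where
  "V_T = {1, zeta, zeta\<^sup>2}"

definition ReIP :: "complex \<Rightarrow> complex \<Rightarrow> real" where
  "ReIP a b = Re (cnj a * b)"

fun H_F :: "complex3 \<Rightarrow> complex \<Rightarrow> real" where
  "H_F (z1, z2, z3) u = ReIP z1 (\<i> * z2) + ReIP u z3"

definition hamiltonian_vanishes :: "complex3 \<Rightarrow> bool" where
  "hamiltonian_vanishes z \<longleftrightarrow> Max (H_F z ` V_T) = 0"


section \<open>The Fuller--Poincare map\<close>

definition walls :: "complex set" where
  "walls = {complex_of_real x * v | x v. x \<le> 0 \<and> v \<in> V_T}"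

text \<open>
  The lexicographic order on triples is spelled out because the order instance on
  products that comes with the analysis library is the componentwise one.
\<close>

fun lex_le :: "real \<times> real \<times> real \<Rightarrow> real \<times> real \<times> real \<Rightarrow> bool" where
  "lex_le (a1, a2, a3) (b1, b2, b3) \<longleftrightarrow>
     a1 < b1 \<or> (a1 = b1 \<and> (a2 < b2 \<or> (a2 = b2 \<and> a3 \<le> b3)))"

fun control_vector :: "complex3 \<Rightarrow> complex \<Rightarrow> real \<times> real \<times> real" where
  "control_vector (z1, z2, z3) u = (ReIP z3 u, ReIP z2 u, ReIP z1 u)"

definition lex_maximal :: "complex3 \<Rightarrow> complex \<Rightarrow> bool" where
  "lex_maximal z u \<longleftrightarrow>
     u \<in> V_T \<and> (\<forall>v\<in>V_T. lex_le (control_vector z v) (control_vector z u))"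

text \<open>
  For \<open>z \<noteq> 0\<close> at most two elements of \<open>V_T\<close> are maximal. If there are two, they are
  \<open>zeta^i\<close> and \<open>zeta^(i+1)\<close> with \<open>i\<close> taken modulo 3, and \<open>zeta^i\<close> is selected.
\<close>

definition first_control :: "complex3 \<Rightarrow> complex" where
  "first_control z =
     (THE u. lex_maximal z u \<and> (\<forall>v. lex_maximal z v \<longrightarrow> v = u \<or> v = zeta * u))"

definition fuller_solution :: "complex \<Rightarrow> complex3 \<Rightarrow> (real \<Rightarrow> complex3) \<Rightarrow> bool" where
  "fuller_solution u z0 z \<longleftrightarrow> z 0 = z0 \<and>
     (\<forall>t. case z t of (z1, z2, z3) \<Rightarrow>
            (z has_vector_derivative (- \<i> * u, z1, z2)) (at t))"

definition fuller_traj :: "complex \<Rightarrow> complex3 \<Rightarrow> real \<Rightarrow> complex3" where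
  "fuller_traj u z0 = (THE z. fuller_solution u z0 z)"

definition switching_time :: "complex3 \<Rightarrow> real" where
  "switching_time z0 =
     (let u = first_control z0 in
      LEAST t. t > 0 \<and>
        (\<exists>u'\<in>V_T - {u}. ReIP (u - u') (snd (snd (fuller_traj u z0 t))) = 0))"

definition fuller_poincare :: "complex3 \<Rightarrow> complex3" where
  "fuller_poincare z0 = fuller_traj (first_control z0) z0 (switching_time z0)"


section \<open>Angular components\<close>

fun phi :: "complex3 \<Rightarrow> real" where
  "phi (z1, z2, z3) = root 6 (cmod z1 ^ 6 + cmod z2 ^ 3 + cmod z3 ^ 2)"

fun dilate :: "real \<Rightarrow> complex3 \<Rightarrow> complex3" where
  "dilate r (z1, z2, z3) =
     (complex_of_real r * z1, complex_of_real (r ^ 2) * z2, complex_of_real (r ^ 3) * z3)"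

definition Xi :: "complex3 set" where
  "Xi = {\<xi>. phi \<xi> = 1}"

definition Xi_W :: "complex3 set" where
  "Xi_W = {\<xi> \<in> Xi. snd (snd \<xi>) \<in> walls}"

definition Xi_W0 :: "complex3 set" where
  "Xi_W0 = {\<xi> \<in> Xi_W. hamiltonian_vanishes \<xi>}"

definition angular :: "complex3 \<Rightarrow> complex3" where
  "angular z = (THE \<xi>. \<xi> \<in> Xi \<and> (\<exists>r>0. z = dilate r \<xi>))"


section \<open>The quotient by \<open>V_T\<close> and the angular map\<close>

fun act :: "complex \<Rightarrow> complex3 \<Rightarrow> complex3" where
  "act v (z1, z2, z3) = (v * z1, v * z2, v * z3)"

definition VT_orbit :: "complex3 \<Rightarrow> complex3 set" where
  "VT_orbit z = (\<lambda>v. act v z) ` V_T"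

definition Xi_W_mod :: "complex3 set topology" where
  "Xi_W_mod = topology (\<lambda>U. U \<subseteq> VT_orbit ` Xi_W \<and>
                            openin (top_of_set Xi_W) {\<xi> \<in> Xi_W. VT_orbit \<xi> \<in> U})"

definition Xi_W0_mod :: "complex3 set topology" where
  "Xi_W0_mod = subtopology Xi_W_mod (VT_orbit ` Xi_W0)"

text \<open>
  All \<open>\<xi>\<close> in one orbit contribute the same orbit to the union, because the
  construction of \<open>fuller_poincare\<close> and \<open>angular\<close> is equivariant under \<open>V_T\<close>.
\<close>

definition F_ang :: "complex3 set \<Rightarrow> complex3 set" where
  "F_ang Q = (\<Union>\<xi>\<in>Q. VT_orbit (angular (fuller_poincare \<xi>)))"


section \<open>The two fixed points\<close>

definition r_out :: real where
  "r_out = (THE r. r > 1 \<and>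
     1 - 5 * r - 7 * r ^ 2 - 5 * r ^ 3 - 7 * r ^ 4 - 5 * r ^ 5 + r ^ 6 = 0)"

definition z_out :: complex3 where
  "z_out =
    (let r = r_out in
      (Complex (- 1) ((- 1 + r) / (sqrt 3 * (1 + r))),
       Complex (- ((- 1 + r ^ 3) / (sqrt 3 * (1 + r ^ 3))))
               ((1 - 3 * r - 2 * r ^ 2 - 3 * r ^ 3 + r ^ 4) / (3 * (1 + r + r ^ 3 + r ^ 4))),
       complex_of_real
         (- 2 * (1 + r - 4 * r ^ 3 - 7 * r ^ 4 - 9 * r ^ 5 - 7 * r ^ 6 - 4 * r ^ 7 + r ^ 9 + r ^ 10)
          / (9 * (1 + r) ^ 2 * (1 - r + r ^ 2) * (1 + r ^ 3 + r ^ 6)))))"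

definition q_out :: "complex3 set" where
  "q_out = VT_orbit (angular z_out)"

fun tau :: "complex3 \<Rightarrow> complex3" where
  "tau (z1, z2, z3) = (cnj z1, - cnj z2, cnj z3)"

definition q_in :: "complex3 set" where
  "q_in = tau ` q_out"


section \<open>Stability of fixed points of a discrete dynamical system\<close>

definition equilibrium :: "'a topology \<Rightarrow> ('a \<Rightarrow> 'a) \<Rightarrow> 'a \<Rightarrow> bool" where
  "equilibrium X f p \<longleftrightarrow> p \<in> topspace X \<and> f p = p"

definition stable_equilibrium :: "'a topology \<Rightarrow> ('a \<Rightarrow> 'a) \<Rightarrow> 'a \<Rightarrow> bool" where
  "stable_equilibrium X f p \<longleftrightarrow> equilibrium X f p \<and>
     (\<forall>U. openin X U \<and> p \<in> U \<longrightarrow>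
        (\<exists>V. openin X V \<and> p \<in> V \<and> (\<forall>x\<in>V. \<forall>n. (f ^^ n) x \<in> U)))"

definition asymptotically_stable_equilibrium :: "'a topology \<Rightarrow> ('a \<Rightarrow> 'a) \<Rightarrow> 'a \<Rightarrow> bool" where
  "asymptotically_stable_equilibrium X f p \<longleftrightarrow> stable_equilibrium X f p \<and>
     (\<exists>V. openin X V \<and> p \<in> V \<and> (\<forall>x\<in>V. limitin X (\<lambda>n. (f ^^ n) x) p sequentially))"

definition unstable_equilibrium :: "'a topology \<Rightarrow> ('a \<Rightarrow> 'a) \<Rightarrow> 'a \<Rightarrow> bool" where
  "unstable_equilibrium X f p \<longleftrightarrow> equilibrium X f p \<and> \<not> stable_equilibrium X f p"


section \<open>The quotient topology and the explicit trajectories\<close>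

lemma openin_Xi_W_mod:
  "openin Xi_W_mod U \<longleftrightarrow> U \<subseteq> VT_orbit ` Xi_W \<and>
     openin (top_of_set Xi_W) {\<xi> \<in> Xi_W. VT_orbit \<xi> \<in> U}"
proof -
  let ?P = "\<lambda>U. {\<xi> \<in> Xi_W. VT_orbit \<xi> \<in> U}"
  have "openin (top_of_set Xi_W) (?P (S \<inter> T))"
    if "openin (top_of_set Xi_W) (?P S)" "openin (top_of_set Xi_W) (?P T)" for S T
  proof -
    have "?P (S \<inter> T) = ?P S \<inter> ?P T" by auto
    then show ?thesis using openin_Int[OF that] by simp
  qed
  moreover have "openin (top_of_set Xi_W) (?P (\<Union>K))"
    if "\<forall>S\<in>K. openin (top_of_set Xi_W) (?P S)" for K
  proof -
    have "?P (\<Union>K) = (\<Union>S\<in>K. ?P S)" by auto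
    then show ?thesis using that by auto
  qed
  ultimately have "istopology (\<lambda>U. U \<subseteq> VT_orbit ` Xi_W \<and> openin (top_of_set Xi_W) (?P U))"
    unfolding istopology_def by (simp add: le_infI1 Sup_le_iff)
  then show ?thesis
    unfolding Xi_W_mod_def by (simp add: topology_inverse')
qed

lemma topspace_Xi_W_mod: "topspace Xi_W_mod = VT_orbit ` Xi_W"
proof
  show "topspace Xi_W_mod \<subseteq> VT_orbit ` Xi_W"
    using openin_Xi_W_mod openin_topspace by blast
  have "{\<xi> \<in> Xi_W. VT_orbit \<xi> \<in> VT_orbit ` Xi_W} = Xi_W" by auto
  then have "openin Xi_W_mod (VT_orbit ` Xi_W)"
    by (simp add: openin_Xi_W_mod)
  then show "VT_orbit ` Xi_W \<subseteq> topspace Xi_W_mod"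
    by (rule openin_subset)
qed

lemma quotient_map_VT_orbit: "quotient_map (top_of_set Xi_W) Xi_W_mod VT_orbit"
  unfolding quotient_map_def by (auto simp: topspace_Xi_W_mod openin_Xi_W_mod)

lemma fuller_solution_components:
  "fuller_solution u z0 z \<longleftrightarrow> z 0 = z0 \<and>
     (\<forall>t. ((\<lambda>t. fst (z t)) has_vector_derivative - \<i> * u) (at t) \<and>
          ((\<lambda>t. fst (snd (z t))) has_vector_derivative fst (z t)) (at t) \<and>
          ((\<lambda>t. snd (snd (z t))) has_vector_derivative fst (snd (z t))) (at t))"
  (is "_ \<longleftrightarrow> ?R")
proof
  assume sol: "fuller_solution u z0 z"
  have z': "(z has_vector_derivative (- \<i> * u, fst (z t), fst (snd (z t)))) (at t)" for t
    using sol unfolding fuller_solution_def case_prod_beta by blast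
  note 1 = bounded_linear.has_vector_derivative[OF bounded_linear_fst z']
  note 2 = bounded_linear.has_vector_derivative[OF bounded_linear_snd z']
  note 3 = bounded_linear.has_vector_derivative[OF bounded_linear_fst 2]
  note 4 = bounded_linear.has_vector_derivative[OF bounded_linear_snd 2]
  show ?R
    using sol 1 3 4 by (auto simp: fuller_solution_def)
next
  assume R: ?R
  have z': "((\<lambda>t. (fst (z t), fst (snd (z t)), snd (snd (z t)))) has_vector_derivative
          (- \<i> * u, fst (z t), fst (snd (z t)))) (at t)" for t
    using R by (intro has_vector_derivative_Pair) auto
  then show "fuller_solution u z0 z"
    using R z' unfolding fuller_solution_def case_prod_beta by simp
qed

lemma same_vector_derivative_eq:
  fixes f g :: "real \<Rightarrow> complex"
  assumes "\<And>t. (f has_vector_derivative h t) (at t)" "\<And>t. (g has_vector_derivative h t) (at t)"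
    and "f 0 = g 0"
  shows "f = g"
proof
  fix t
  have "((\<lambda>t. f t - g t) has_vector_derivative 0) (at s)" for s
    using has_vector_derivative_diff[OF assms(1) assms(2)] by simp
  then obtain c where "\<And>s. f s - g s = c"
    using has_vector_derivative_zero_constant[of UNIV "\<lambda>t. f t - g t"] by auto
  then show "f t = g t" using assms(3) by (metis eq_iff_diff_eq_0)
qed

lemma fuller_traj_eq:
  "fuller_traj u (z1, z2, z3) = (\<lambda>t. let s = complex_of_real t in
     (z1 - \<i> * u * s,
      z2 + z1 * s - \<i> * u * s ^ 2 / 2,
      z3 + z2 * s + z1 * s ^ 2 / 2 - \<i> * u * s ^ 3 / 6))"
  (is "_ = ?z")
  unfolding fuller_traj_def
proof (rule the_equality)
  show sol: "fuller_solution u (z1, z2, z3) ?z"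
    unfolding fuller_solution_components Let_def
    by (auto intro!: derivative_eq_intros has_vector_derivative_real_field
        simp: field_simps power2_eq_square)
  fix y assume y: "fuller_solution u (z1, z2, z3) y"
  have 1: "(\<lambda>t. fst (y t)) = (\<lambda>t. fst (?z t))"
    using y sol by (intro same_vector_derivative_eq) (auto simp: fuller_solution_components)
  have 2: "(\<lambda>t. fst (snd (y t))) = (\<lambda>t. fst (snd (?z t)))"
    using y sol fun_cong[OF 1]
    by (intro same_vector_derivative_eq[where h = "\<lambda>t. fst (?z t)"])
       (auto simp: fuller_solution_components)
  have 3: "(\<lambda>t. snd (snd (y t))) = (\<lambda>t. snd (snd (?z t)))"
    using y sol fun_cong[OF 2]
    by (intro same_vector_derivative_eq[where h = "\<lambda>t. fst (snd (?z t))"])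
       (auto simp: fuller_solution_components)
  show "y = ?z"
    using fun_cong[OF 1] fun_cong[OF 2] fun_cong[OF 3] by (intro ext prod_eqI) auto
qed

end

theory Submission
  imports Defs
begin

text \<open>
  Near \<open>q_out\<close> the three-dimensional phase space has explicit coordinates \<open>(a, b, y)\<close>. There the
  control is \<open>zeta\<close>, and the gap between \<open>zeta\<close> and \<open>zeta\<^sup>2\<close> is a polynomial in time with positive
  coefficients, so the switching is always to \<open>1\<close>, at the unique positive root (Descartes) of a
  cubic. The return map is then explicit up to this root, and a direct estimate of its differences
  to the fixed point shows that it maps the cube of radius \<open>e \<le> 1/100\<close> around \<open>q_out\<close> into the one
  of radius \<open>e / 2\<close>. This gives asymptotic stability of \<open>q_out\<close>.

  The involution \<open>tau\<close> reverses time, so it conjugates \<open>F_ang\<close> to its local inverse. If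
  \<open>Q \<noteq> q_out\<close> is attracted to \<open>q_out\<close>, the points \<open>tau (F_ang\<^sup>n Q)\<close> tend to \<open>q_in\<close>, but \<open>n\<close> steps of
  \<open>F_ang\<close> carry them to \<open>tau Q \<noteq> q_in\<close>; hence \<open>q_in\<close> is unstable.
\<close>

section \<open>The outward fixed point\<close>

definition sextic :: "real \<Rightarrow> real" where
  "sextic r = 1 - 5 * r - 7 * r ^ 2 - 5 * r ^ 3 - 7 * r ^ 4 - 5 * r ^ 5 + r ^ 6"

text \<open>The sextic is palindromic, so dividing by x^3 turns it into a cubic in x + 1/x. A root x
  > 1 makes x + 1/x a root of this cubic above 5; two such roots coincide because the cofactor of
  their difference is positive there. Finally x + 1/x is injective on x > 1.\<close>

lemma sextic_root_unique:
  assumes "r > 1" "sextic r = 0" "r' > 1" "sextic r' = 0"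
  shows "r = r'"
proof -
  define h where "h x = x + 1 / x" for x :: real
  have cubic: "h x ^ 3 - 5 * h x ^ 2 - 10 * h x + 5 = 0 \<and> h x > 5" if "x > 1" "sextic x = 0" for x
  proof -
    have "x ^ 3 * (h x ^ 3 - 5 * h x ^ 2 - 10 * h x + 5) = sextic x"
      using that(1) unfolding h_def sextic_def by (simp add: field_simps) algebra
    then have c: "h x ^ 3 - 5 * h x ^ 2 - 10 * h x + 5 = 0"
      using that by auto
    have "h x - 2 = (x - 1) ^ 2 / x"
      using that(1) unfolding h_def by (simp add: field_simps power2_eq_square)
    moreover have "(x - 1) ^ 2 / x > 0"
      using that(1) by (intro divide_pos_pos) auto
    ultimately have "h x > 2" by simp
    moreover have "h x ^ 2 * (h x - 5) = 10 * h x - 5"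
      using c by algebra
    ultimately have "h x ^ 2 * (h x - 5) > 0" by linarith
    then show ?thesis
      using c by (simp add: zero_less_mult_iff)
  qed
  let ?s = "h r" and ?t = "h r'"
  have s: "?s ^ 3 - 5 * ?s ^ 2 - 10 * ?s + 5 = 0" "?s > 5"
    and t: "?t ^ 3 - 5 * ?t ^ 2 - 10 * ?t + 5 = 0" "?t > 5"
    using cubic assms by auto
  have "(?s - ?t) * (?s * (?s - 5) + ?t * (?t - 5) + ?s * ?t - 10) = 0"
    using s t by algebra
  moreover have "?s * (?s - 5) > 0" "?t * (?t - 5) > 0"
    using s t by auto
  moreover have "?s * ?t > 5 * 5"
    using s t by (intro mult_strict_mono) auto
  ultimately have "?s = ?t" by auto
  then have "(r - r') * (r * r' - 1) = 0"
    using assms unfolding h_def by (simp add: field_simps)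
  moreover have "r * r' > 1 * 1"
    using assms by (intro mult_strict_mono) auto
  ultimately show ?thesis by auto
qed

text \<open>The sextic changes sign on a bracket of width 1/1000, narrow enough for the decimal
  bounds in \<open>base_bounds\<close>.\<close>

lemma r_out: "sextic r_out = 0" "(3137/500) \<le> r_out" "r_out \<le> (251/40)"
proof -
  have "continuous_on {3137/500..251/40} sextic"
    unfolding sextic_def by (intro continuous_intros)
  then obtain r where r: "(3137/500) \<le> r" "r \<le> (251/40)" "sextic r = 0"
    using IVT'[of sextic "(3137/500)" 0 "(251/40)"] by (auto simp: sextic_def eval_nat_numeral)
  have "r_out = r"
    unfolding r_out_def sextic_def[symmetric]
    by (rule the_equality) (use r sextic_root_unique in auto)
  then show "sextic r_out = 0" "(3137/500) \<le> r_out" "r_out \<le> (251/40)"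
    using r by auto
qed

text \<open>
  Coordinates of \<open>z_out\<close> in the chart introduced below, and its switching time divided by
  \<open>sqrt 3\<close>; this normalisation keeps everything rational in \<open>r_out\<close>.
\<close>

definition "a_out = (r_out - 1) / (r_out + 1)"
definition "b_out = - (r_out ^ 3 - 1) / (r_out ^ 3 + 1)"
definition "y_out = (1 - 3 * r_out - 2 * r_out ^ 2 - 3 * r_out ^ 3 + r_out ^ 4)
  / (3 * (1 + r_out + r_out ^ 3 + r_out ^ 4))"
definition "t_out = 2 * (r_out ^ 2 + r_out + 1) / (3 * (r_out + 1))"

text \<open>
  Along the trajectory starting at the chart point \<open>(a, b, y)\<close> with control \<open>zeta\<close>, at time
  \<open>sqrt 3 * t\<close>, this is \<open>-4/3\<close> times the amount by which \<open>zeta\<close> beats the control \<open>1\<close>.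
\<close>

definition switch_poly :: "real \<Rightarrow> real \<Rightarrow> real \<Rightarrow> real \<Rightarrow> real" where
  "switch_poly a b y t = t ^ 3 - (3 + a) * t ^ 2 + 2 * (b - y) * t + 4 * y + 4 / 3 * a * b"

lemma r_out_nz: "r_out + 1 \<noteq> 0" "r_out ^ 3 + 1 \<noteq> 0" "1 + r_out + r_out ^ 3 + r_out ^ 4 \<noteq> 0"
proof -
  have "r_out > 0" using r_out(2) by simp
  then have "r_out + 1 > 0" "r_out ^ 3 + 1 > 0" "1 + r_out + r_out ^ 3 + r_out ^ 4 > 0"
    by (auto intro!: add_pos_pos)
  then show "r_out + 1 \<noteq> 0" "r_out ^ 3 + 1 \<noteq> 0" "1 + r_out + r_out ^ 3 + r_out ^ 4 \<noteq> 0"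
    by linarith+
qed

text \<open>The denominator of \<open>y_out\<close> is factored so that it shares its factors with
  those of \<open>a_out\<close> and \<open>b_out\<close>.\<close>

lemma base_denoms:
  "b_out * (r_out ^ 3 + 1) = 1 - r_out ^ 3"
  "y_out * (3 * ((r_out + 1) * (r_out ^ 3 + 1))) =
     1 - 3 * r_out - 2 * r_out ^ 2 - 3 * r_out ^ 3 + r_out ^ 4"
proof -
  have "(r_out + 1) * (r_out ^ 3 + 1) = 1 + r_out + r_out ^ 3 + r_out ^ 4"
    by algebra
  then show "y_out * (3 * ((r_out + 1) * (r_out ^ 3 + 1))) =
     1 - 3 * r_out - 2 * r_out ^ 2 - 3 * r_out ^ 3 + r_out ^ 4"
    using r_out_nz unfolding y_out_def by simp
qed (use r_out_nz in \<open>auto simp: b_out_def\<close>)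

text \<open>These equations say that the return map, with \<open>3 * t + a - 1\<close> as twice its
  dilation factor, fixes the base point; \<open>r_out\<close> is thus the factor by which one step
  expands. The first four are rational identities in \<open>r_out\<close>. The sextic enters only in
  the last one, where it is the condition that \<open>t_out\<close> is a switching time.\<close>

lemma base_fixed:
  "3 * t_out + a_out - 1 = 2 * r_out"
  "a_out * (3 * t_out + a_out - 1) = 3 * t_out - 3 - a_out"
  "b_out * (3 * t_out + a_out - 1) ^ 2 = - 2 * (b_out + 3 * y_out + 3 * (a_out - 1) * t_out + 9 / 2 * t_out ^ 2)"
  "y_out * (3 * t_out + a_out - 1) ^ 2 = 2 * (b_out - y_out - (3 + a_out) * t_out + 3 / 2 * t_out ^ 2)"
  "switch_poly a_out b_out y_out t_out = 0"
proof -
  let ?r = r_out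
  have a: "a_out = (?r - 1) / (?r + 1)" and t: "t_out = 2 * (?r ^ 2 + ?r + 1) / (3 * (?r + 1))"
    unfolding a_out_def t_out_def by auto
  show D: "3 * t_out + a_out - 1 = 2 * ?r"
    unfolding a t using r_out_nz by (simp add: divide_simps) algebra
  show "a_out * (3 * t_out + a_out - 1) = 3 * t_out - 3 - a_out"
    unfolding D unfolding a t using r_out_nz by (simp add: divide_simps) algebra
  have b: "b_out = (1 - ?r ^ 3) / (?r ^ 3 + 1)"
    using base_denoms(1) r_out_nz by (simp add: nonzero_eq_divide_eq)
  have y: "y_out = (1 - 3 * ?r - 2 * ?r ^ 2 - 3 * ?r ^ 3 + ?r ^ 4) / (3 * ((?r + 1) * (?r ^ 3 + 1)))"
    using base_denoms(2) r_out_nz by (simp add: nonzero_eq_divide_eq)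
  show "b_out * (3 * t_out + a_out - 1) ^ 2 = - 2 * (b_out + 3 * y_out + 3 * (a_out - 1) * t_out + 9 / 2 * t_out ^ 2)"
    unfolding D unfolding a b t y using r_out_nz by (simp add: divide_simps) algebra
  show "y_out * (3 * t_out + a_out - 1) ^ 2 = 2 * (b_out - y_out - (3 + a_out) * t_out + 3 / 2 * t_out ^ 2)"
    unfolding D unfolding a b t y using r_out_nz by (simp add: divide_simps) algebra
  have "sextic ?r = 0" by (rule r_out)
  then show "switch_poly a_out b_out y_out t_out = 0"
    unfolding switch_poly_def a b t y sextic_def using r_out_nz by (simp add: divide_simps) algebra
qed

lemma base_bounds:
  "(18/25) \<le> a_out" "a_out \<le> (73/100)" "-(993/1000) \<le> b_out" "b_out \<le> -(99/100)" "(13/100) \<le> y_out" "y_out \<le> (133/1000)"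
  "(427/100) \<le> t_out" "t_out \<le> (107/25)"
proof -
  let ?r = r_out
  note r = r_out(2,3)
  have r2: "(984/25) \<le> ?r ^ 2" "?r ^ 2 \<le> (1969/50)"
    using power_mono[OF r(1), of 2] power_mono[OF r(2), of 2] r by (auto simp: eval_nat_numeral)
  have r3: "(2469/10) \<le> ?r ^ 3" "?r ^ 3 \<le> (2471/10)"
    using power_mono[OF r(1), of 3] power_mono[OF r(2), of 3] r by (auto simp: eval_nat_numeral)
  have r4: "(7747/5) \<le> ?r ^ 4" "?r ^ 4 \<le> (3101/2)"
    using power_mono[OF r(1), of 4] power_mono[OF r(2), of 4] r by (auto simp: eval_nat_numeral)
  have "?r + 1 > 0" "?r ^ 3 + 1 > 0" "3 * (?r + 1) > 0" "3 * (1 + ?r + ?r ^ 3 + ?r ^ 4) > 0"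
    using r r3 r4 by auto
  note pos = this
  show "(18/25) \<le> a_out"
    unfolding a_out_def pos_le_divide_eq[OF pos(1)] pos_divide_le_eq[OF pos(1)]
    using r r2 r3 r4 by (simp add: field_simps)
  show "a_out \<le> (73/100)"
    unfolding a_out_def pos_le_divide_eq[OF pos(1)] pos_divide_le_eq[OF pos(1)]
    using r r2 r3 r4 by (simp add: field_simps)
  show "-(993/1000) \<le> b_out"
    unfolding b_out_def pos_le_divide_eq[OF pos(2)] pos_divide_le_eq[OF pos(2)]
    using r r2 r3 r4 by (simp add: field_simps)
  show "b_out \<le> -(99/100)"
    unfolding b_out_def pos_le_divide_eq[OF pos(2)] pos_divide_le_eq[OF pos(2)]
    using r r2 r3 r4 by (simp add: field_simps)
  show "(13/100) \<le> y_out"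
    unfolding y_out_def pos_le_divide_eq[OF pos(4)] pos_divide_le_eq[OF pos(4)]
    using r r2 r3 r4 by (simp add: field_simps)
  show "y_out \<le> (133/1000)"
    unfolding y_out_def pos_le_divide_eq[OF pos(4)] pos_divide_le_eq[OF pos(4)]
    using r r2 r3 r4 by (simp add: field_simps)
  show "(427/100) \<le> t_out"
    unfolding t_out_def pos_le_divide_eq[OF pos(3)] pos_divide_le_eq[OF pos(3)]
    using r r2 r3 r4 by (simp add: field_simps)
  show "t_out \<le> (107/25)"
    unfolding t_out_def pos_le_divide_eq[OF pos(3)] pos_divide_le_eq[OF pos(3)]
    using r r2 r3 r4 by (simp add: field_simps)
qed

section \<open>The contraction estimate\<close>

lemma abs_mult_le:
  fixes x y :: real
  assumes "\<bar>x\<bar> \<le> p" "\<bar>y\<bar> \<le> q"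
  shows "\<bar>x * y\<bar> \<le> p * q"
  using assms by (simp add: abs_mult mult_mono order_trans[OF abs_ge_zero])

lemma abs_divide_less:
  fixes x d :: real
  assumes "\<bar>x\<bar> \<le> p" "q \<le> d" "0 < q" "p < c * q" "0 \<le> c"
  shows "\<bar>x / d\<bar> < c"
proof -
  have "\<bar>x\<bar> < c * d"
    using assms mult_left_mono[of q d c] by linarith
  then show ?thesis
    using assms by (simp add: pos_divide_less_eq)
qed

definition cube :: "real \<Rightarrow> (real \<times> real \<times> real) set" where
  "cube e = {(a, b, y). \<bar>a - a_out\<bar> < e \<and> \<bar>b - b_out\<bar> < e \<and> \<bar>y - y_out\<bar> < e}"

text \<open>Subtracting the cubic equations at the point and at the base point gives
  \<open>t - t_out\<close>, times a divided difference \<open>E\<close>, as a linear combination of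
  the coordinate deviations. Its coefficients sum to at most 34, and 34 / 15.9 < 11/5.\<close>

lemma switch_poly_root_near:
  assumes x: "(a, b, y) \<in> cube e" and e: "e \<le> 1/100"
    and t: "t > 0" "switch_poly a b y t = 0"
  shows "\<bar>t - t_out\<bar> \<le> (11/5) * e"
proof -
  note B = base_bounds
  define da db dy where "da = a - a_out" and "db = b - b_out" and "dy = y - y_out"
  have d: "\<bar>da\<bar> \<le> e" "\<bar>db\<bar> \<le> e" "\<bar>dy\<bar> \<le> e"
    using x by (auto simp: cube_def da_def db_def dy_def)
  have R: "(71/100) \<le> a" "a \<le> (37/50)" "-(1003/1000) \<le> b" "b \<le> -(49/50)" "(3/25) \<le> y" "y \<le> (143/1000)"
    using d B e unfolding da_def db_def dy_def by linarith+
  have "(71/100) * (49/50) \<le> a * (- b)"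
    using R by (intro mult_mono) auto
  then have ab: "4 * y + 4 / 3 * a * b < 0"
    using R by simp
  have "(y - b) * t > 0"
    using R t by simp
  \<comment> \<open>The root equation with the leading terms isolated: the right side is positive,
    which forces \<open>t > 3 + a\<close> and keeps \<open>E\<close> away from zero.\<close>
  moreover have "t ^ 2 * (t - 3 - a) = 2 * ((y - b) * t) - (4 * y + 4 / 3 * a * b)"
    using t(2) unfolding switch_poly_def by algebra
  ultimately have "t ^ 2 * (t - 3 - a) > 0"
    using ab by linarith
  then have t3: "t - 3 - a > 0"
    by (simp add: zero_less_mult_iff)
  \<comment> \<open>\<open>E\<close> is the divided difference of \<open>switch_poly a b y\<close>
    between \<open>t\<close> and \<open>t_out\<close>, grouped so that \<open>u\<close> is positive
    and \<open>v\<close> is at least the square of the lower bound for \<open>t_out\<close>.\<close>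
  define u v where "u = t * (t - 3 - a)" and "v = t_out * (t - 3 - a + t_out)"
  define E where "E = u + v + 2 * (b - y)"
  have "u > 0" using t t3 by (simp add: u_def)
  moreover have "(427/100) * (427/100) \<le> v"
    unfolding v_def using B t3 by (intro mult_mono) auto
  ultimately have E: "E \<ge> (159/10)"
    using R unfolding E_def by simp
  have "(t - t_out) * E = da * (t_out * t_out - 4 / 3 * b) - db * (2 * t_out + 4 / 3 * a_out) + dy * (2 * t_out - 4)"
    using t(2) base_fixed(5) unfolding switch_poly_def E_def u_def v_def da_def db_def dy_def by algebra
  moreover have "\<bar>da * (t_out * t_out - 4 / 3 * b)\<bar> \<le> e * (99/5)"
  proof (rule abs_mult_le[OF d(1)])
    have "t_out * t_out \<le> (107/25) * (107/25)"
      using B by (intro mult_mono) auto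
    moreover have "0 \<le> t_out * t_out" by simp
    ultimately show "\<bar>t_out * t_out - 4 / 3 * b\<bar> \<le> (99/5)" using R by linarith
  qed
  moreover have "\<bar>db * (2 * t_out + 4 / 3 * a_out)\<bar> \<le> e * (48/5)"
    using B by (intro abs_mult_le d) (simp add: abs_le_iff)
  moreover have "\<bar>dy * (2 * t_out - 4)\<bar> \<le> e * (23/5)"
    using B by (intro abs_mult_le d) (simp add: abs_le_iff)
  ultimately have "\<bar>(t - t_out) * E\<bar> \<le> 34 * e"
    by linarith
  moreover have "\<bar>t - t_out\<bar> * (159/10) \<le> \<bar>(t - t_out) * E\<bar>"
    using E mult_left_mono[OF E, of "\<bar>t - t_out\<bar>"] by (simp add: abs_mult)
  ultimately have "\<bar>t - t_out\<bar> * (159/10) \<le> 34 * e" by (rule order_trans[rotated])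
  moreover have "e \<ge> 0" using d by linarith
  ultimately show ?thesis by simp
qed

text \<open>The triple is the image under the return map, as \<open>act_zeta_traj_chart\<close>
  shows. Each deviation of the image is a numerator minus the base coordinate times a power of
  \<open>D\<close>, divided by that power. By \<open>base_fixed\<close> this difference vanishes at
  the base point, so it is linear in the deviations with bounded coefficients. The totals 4, 30 and
  40 are beaten by \<open>D >= 12.4\<close> and \<open>D ^ 2 >= 153\<close>.\<close>

lemma cube_contraction:
  assumes x: "(a, b, y) \<in> cube e" and e: "e \<le> 1/100"
    and t: "t > 0" "switch_poly a b y t = 0" and D: "D = 3 * t + a - 1"
  shows "D > 12"
    and "((3 * t - 3 - a) / D,
          - 2 * (b + 3 * y + 3 * (a - 1) * t + 9 / 2 * t ^ 2) / D ^ 2,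
          2 * (b - y - (3 + a) * t + 3 / 2 * t ^ 2) / D ^ 2) \<in> cube (e / 2)"
proof -
  note B = base_bounds
  define da db dy dt where "da = a - a_out" and "db = b - b_out" and "dy = y - y_out" and "dt = t - t_out"
  have d: "\<bar>da\<bar> \<le> e" "\<bar>db\<bar> \<le> e" "\<bar>dy\<bar> \<le> e" and e0: "e > 0"
    using x by (auto simp: cube_def da_def db_def dy_def)
  have dt: "\<bar>dt\<bar> \<le> (11/5) * e"
    using switch_poly_root_near[OF x e t] by (simp add: dt_def)
  have R: "(71/100) \<le> a" "a \<le> (37/50)" "(531/125) \<le> t" "t \<le> (2151/500)"
    using d dt B e unfolding da_def dt_def by linarith+
  then show D12: "D > 12" unfolding D by linarith
  have D_ge: "(62/5) \<le> D" using R unfolding D by linarith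
  then have D2: "153 \<le> D ^ 2"
    using power_mono[OF D_ge, of 2] by (simp add: power2_eq_square)
  define D0 where "D0 = 3 * t_out + a_out - 1"
  have DD0: "(249/10) \<le> D + D0" "D + D0 \<le> (253/10)"
    using R B unfolding D D0_def by linarith+
  have dD: "D - D0 = 3 * dt + da"
    unfolding D D0_def dt_def da_def by simp
  note F = base_fixed(2-4)[folded D0_def]
  have "\<bar>(3 * t - 3 - a) / D - a_out\<bar> < e / 2"
  proof -
    have "(3 * t - 3 - a) - a_out * D = dt * (3 * (1 - a_out)) - da * (1 + a_out)"
      using F(1) unfolding D D0_def dt_def da_def by algebra
    moreover have "\<bar>dt * (3 * (1 - a_out))\<bar> \<le> (11/5) * e * (21/25)" "\<bar>da * (1 + a_out)\<bar> \<le> e * (173/100)"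
      using B by (intro abs_mult_le dt d; simp add: abs_le_iff)+
    ultimately have "\<bar>(3 * t - 3 - a) - a_out * D\<bar> \<le> 4 * e"
      using e0 by linarith
    then have "\<bar>((3 * t - 3 - a) - a_out * D) / D\<bar> < e / 2"
      using D_ge e0 by (intro abs_divide_less[where q = "62/5" and p = "4 * e"]) auto
    then show ?thesis using D12 by (simp add: diff_divide_distrib)
  qed
  moreover have "\<bar>- 2 * (b + 3 * y + 3 * (a - 1) * t + 9 / 2 * t ^ 2) / D ^ 2 - b_out\<bar> < e / 2"
  proof -
    let ?M = "- 2 * (b + 3 * y + 3 * (a - 1) * t + 9 / 2 * t ^ 2)"
    \<comment> \<open>The coefficient of \<open>dt\<close> is a small difference of numbers near 75, so it has to be bounded
      as a whole.\<close>
    define p where "p = - 6 * (a - 1) - 9 * (t + t_out) - 3 * b_out * (D + D0)"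
    \<comment> \<open>Since \<open>b_out\<close> is close to -1, the large terms of \<open>p\<close>
      cancel up to the small factor \<open>1 + b_out\<close> in \<open>v\<close>.\<close>
    define v w where "v = (1 + b_out) * (t + t_out)" and "w = b_out * (a + a_out - 2)"
    have "(7/1000) * (4259/500) \<le> v" "v \<le> (1/100) * (4291/500)"
      unfolding v_def using B R by (intro mult_mono; simp)+
    moreover have "\<bar>w\<bar> \<le> (993/1000) * (57/100)"
      unfolding w_def using B R by (intro abs_mult_le) (auto simp: abs_le_iff)
    then have "w \<le> 1" "- 1 \<le> w" by (simp_all add: abs_le_iff)
    moreover have "p = - 9 * v - 6 * (a - 1) - 3 * w"
      unfolding p_def v_def w_def D D0_def by algebra
    ultimately have "\<bar>p\<bar> \<le> 5" using R \<open>w \<le> 1\<close> \<open>- 1 \<le> w\<close> by (simp add: abs_le_iff)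
    then have "\<bar>dt * p\<bar> \<le> (11/5) * e * 5"
      by (intro abs_mult_le dt)
    moreover have "(99/100) * (249/10) \<le> (- b_out) * (D + D0)" "(- b_out) * (D + D0) \<le> (993/1000) * (253/10)"
      using B DD0 by (intro mult_mono; simp)+
    then have "\<bar>da * (- 6 * t_out - b_out * (D + D0))\<bar> \<le> e * 2"
      using B by (intro abs_mult_le d) (auto simp: abs_le_iff)
    moreover have "?M - b_out * D ^ 2
        = - 2 * db - 6 * dy + da * (- 6 * t_out - b_out * (D + D0)) + dt * p"
      using F(2) dD unfolding p_def dt_def da_def db_def dy_def by algebra
    ultimately have "\<bar>?M - b_out * D ^ 2\<bar> \<le> 30 * e"
      using d by linarith
    then have "\<bar>(?M - b_out * D ^ 2) / D ^ 2\<bar> < e / 2"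
      using D2 e0 by (intro abs_divide_less[where q = 153 and p = "30 * e"]) auto
    then show ?thesis using D12 by (simp add: diff_divide_distrib)
  qed
  moreover have "\<bar>2 * (b - y - (3 + a) * t + 3 / 2 * t ^ 2) / D ^ 2 - y_out\<bar> < e / 2"
  proof -
    let ?M = "2 * (b - y - (3 + a) * t + 3 / 2 * t ^ 2)"
    have y: "(13/100) * (249/10) \<le> y_out * (D + D0)" "y_out * (D + D0) \<le> (133/1000) * (253/10)"
      using B DD0 by (intro mult_mono; simp)+
    define p where "p = - 2 * (3 + a) + 3 * (t + t_out) - 3 * (y_out * (D + D0))"
    have "\<bar>p\<bar> \<le> 10" using R B y unfolding p_def by (simp add: abs_le_iff)
    then have "\<bar>dt * p\<bar> \<le> (11/5) * e * 10"
      by (intro abs_mult_le dt)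
    moreover have "\<bar>da * (- 2 * t_out - y_out * (D + D0))\<bar> \<le> e * 13"
      using B y by (intro abs_mult_le d) (auto simp: abs_le_iff)
    moreover have "?M - y_out * D ^ 2
        = 2 * db - 2 * dy + da * (- 2 * t_out - y_out * (D + D0)) + dt * p"
      using F(3) dD unfolding p_def dt_def da_def db_def dy_def by algebra
    ultimately have "\<bar>?M - y_out * D ^ 2\<bar> \<le> 40 * e"
      using d by linarith
    then have "\<bar>(?M - y_out * D ^ 2) / D ^ 2\<bar> < e / 2"
      using D2 e0 by (intro abs_divide_less[where q = 153 and p = "40 * e"]) auto
    then show ?thesis using D12 by (simp add: diff_divide_distrib)
  qed
  ultimately show "((3 * t - 3 - a) / D,
          - 2 * (b + 3 * y + 3 * (a - 1) * t + 9 / 2 * t ^ 2) / D ^ 2,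
          2 * (b - y - (3 + a) * t + 3 / 2 * t ^ 2) / D ^ 2) \<in> cube (e / 2)"
    by (simp add: cube_def)
qed

section \<open>Symmetries and the first switching\<close>

lemma zeta_eq: "zeta = Complex (- 1 / 2) (sqrt 3 / 2)"
proof -
  have "2 * complex_of_real pi * \<i> / 3 = \<i> * complex_of_real (2 * pi / 3)"
    by simp
  then have "zeta = cis (2 * pi / 3)"
    unfolding zeta_def cis_conv_exp by (rule arg_cong)
  then show ?thesis
    by (simp add: complex_eq_iff cos_120 sin_120)
qed

lemma zeta_power2_eq: "zeta\<^sup>2 = Complex (- 1 / 2) (- sqrt 3 / 2)"
  by (simp add: zeta_eq complex_eq_iff power2_eq_square)

lemma zeta_power3: "zeta ^ 3 = 1"
  by (simp add: zeta_eq complex_eq_iff power3_eq_cube field_simps)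

lemma V_T_mult: "u \<in> V_T \<Longrightarrow> v \<in> V_T \<Longrightarrow> u * v \<in> V_T"
  using zeta_power3 unfolding V_T_def
  by (auto simp: power2_eq_square power3_eq_cube mult.assoc)

lemma V_T_cnj: "v \<in> V_T \<Longrightarrow> cnj v \<in> V_T"
  unfolding V_T_def zeta_power2_eq by (auto simp: zeta_eq complex_eq_iff)

lemma V_T_norm: "v \<in> V_T \<Longrightarrow> cmod v = 1"
  unfolding V_T_def zeta_power2_eq by (auto simp: zeta_eq cmod_def power2_eq_square field_simps)

lemma V_T_cnj_mult: "v \<in> V_T \<Longrightarrow> cnj v * v = 1"
  using complex_norm_square[of v] by (simp add: V_T_norm mult.commute)

lemma V_T_elements: "1 \<in> V_T" "zeta \<in> V_T" "zeta\<^sup>2 \<in> V_T"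
  by (auto simp: V_T_def)

lemma V_T_distinct: "zeta \<noteq> 1" "zeta\<^sup>2 \<noteq> 1" "zeta\<^sup>2 \<noteq> zeta"
  unfolding zeta_power2_eq by (auto simp: zeta_eq complex_eq_iff)

lemma cnj_zeta: "cnj zeta = zeta\<^sup>2" "cnj (zeta\<^sup>2) = zeta"
  unfolding zeta_power2_eq by (auto simp: zeta_eq complex_eq_iff)

lemma mult_V_T_image: "v \<in> V_T \<Longrightarrow> (*) v ` V_T = V_T"
proof -
  assume v: "v \<in> V_T"
  have "w = v * (cnj v * w)" for w
    using V_T_cnj_mult[OF v] by (simp add: mult.assoc[symmetric] mult.commute[of v])
  moreover have "cnj v * w \<in> V_T" if "w \<in> V_T" for w
    using V_T_mult V_T_cnj v that by blast
  ultimately show ?thesis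
    using V_T_mult[OF v] by blast
qed

lemma cnj_V_T_image: "cnj ` V_T = V_T"
  using V_T_cnj by (force intro: image_eqI[where x = "cnj _"])

text \<open>Multiplication by \<open>v\<close> permutes \<open>V_T\<close>, so claims about the
  competitors of \<open>v * u\<close> may be checked on translates of the competitors of
  \<open>u\<close>.\<close>

lemma V_T_wlog_mult:
  assumes v: "v \<in> V_T" and "\<And>w. w \<in> V_T - {u} \<Longrightarrow> P (v * w)" and "w \<in> V_T - {v * u}"
  shows "P w"
proof -
  obtain w' where "w' \<in> V_T" "w = v * w'"
    using mult_V_T_image[OF v] assms(3) by blast
  then show ?thesis using assms by auto
qed

section \<open>Rotations, the involution, dilations and the angular component\<close>

lemma act_act: "act v (act w z) = act (v * w) z"
  by (cases z) (simp add: mult.assoc)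

lemma act_one [simp]: "act 1 z = z"
  by (cases z) simp

lemma VT_orbit_act: "v \<in> V_T \<Longrightarrow> VT_orbit (act v z) = VT_orbit z"
proof -
  assume v: "v \<in> V_T"
  have "VT_orbit (act v z) = (\<lambda>w. act w z) ` (*) v ` V_T"
    by (auto simp: VT_orbit_def act_act image_image mult.commute)
  then show ?thesis
    using v by (simp add: mult_V_T_image VT_orbit_def)
qed

lemma VT_orbit_self: "z \<in> VT_orbit z"
  unfolding VT_orbit_def using V_T_elements(1) act_one by (metis image_eqI)

lemma VT_orbit_eq_iff: "VT_orbit z = VT_orbit w \<longleftrightarrow> (\<exists>v\<in>V_T. z = act v w)"
proof
  assume "VT_orbit z = VT_orbit w"
  then have "z \<in> VT_orbit w" using VT_orbit_self by blast
  then show "\<exists>v\<in>V_T. z = act v w" by (auto simp: VT_orbit_def)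
next
  assume "\<exists>v\<in>V_T. z = act v w"
  then show "VT_orbit z = VT_orbit w" using VT_orbit_act by blast
qed

lemma tau_act: "tau (act v z) = act (cnj v) (tau z)"
  by (cases z) simp

lemma tau_tau [simp]: "tau (tau z) = z"
  by (cases z) simp

lemma tau_dilate: "tau (dilate r z) = dilate r (tau z)"
  by (cases z) simp

lemma tau_VT_orbit: "tau ` VT_orbit z = VT_orbit (tau z)"
proof -
  have "tau ` VT_orbit z = (\<lambda>v. act v (tau z)) ` cnj ` V_T"
    by (simp add: VT_orbit_def image_image tau_act)
  then show ?thesis by (simp add: cnj_V_T_image VT_orbit_def)
qed

lemma dilate_dilate: "dilate r (dilate s z) = dilate (r * s) z"
  by (cases z) (simp add: power_mult_distrib mult.assoc)

lemma dilate_one [simp]: "dilate 1 z = z"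
  by (cases z) simp

lemma dilate_act: "dilate r (act v z) = act v (dilate r z)"
  by (cases z) (simp add: mult.left_commute)

lemma phi_dilate:
  assumes "r > 0"
  shows "phi (dilate r z) = r * phi z"
proof (cases z)
  case (fields z1 z2 z3)
  have "cmod (r * z1) ^ 6 + cmod (complex_of_real (r ^ 2) * z2) ^ 3
      + cmod (complex_of_real (r ^ 3) * z3) ^ 2
    = r ^ 6 * (cmod z1 ^ 6 + cmod z2 ^ 3 + cmod z3 ^ 2)"
    using assms
    by (simp add: norm_mult norm_power power_mult_distrib power_mult[symmetric] algebra_simps)
  then have "phi (dilate r z) = root 6 (r ^ 6 * (cmod z1 ^ 6 + cmod z2 ^ 3 + cmod z3 ^ 2))"
    unfolding fields dilate.simps phi.simps by (rule arg_cong)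
  also have "\<dots> = r * phi z"
    using assms fields by (simp add: real_root_mult real_root_power_cancel)
  finally show ?thesis .
qed

lemma phi_act: "v \<in> V_T \<Longrightarrow> phi (act v z) = phi z"
  by (cases z) (simp add: norm_mult V_T_norm)

lemma phi_tau: "phi (tau z) = phi z"
  by (cases z) simp

lemma phi_pos:
  assumes "z \<noteq> 0"
  shows "phi z > 0"
proof (cases z)
  case (fields z1 z2 z3)
  then have "cmod z1 ^ 6 > 0 \<or> cmod z2 ^ 3 > 0 \<or> cmod z3 ^ 2 > 0"
    using assms by (auto simp: zero_prod_def)
  then have "cmod z1 ^ 6 + cmod z2 ^ 3 + cmod z3 ^ 2 > 0"
    by (smt (verit) norm_ge_zero zero_le_power)
  then show ?thesis using fields by simp
qed

text \<open>Homogeneity of \<open>phi\<close> of degree one under dilations forces the radius to be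
  \<open>phi z\<close>.\<close>

lemma angular_eq:
  assumes "z \<noteq> 0"
  shows "angular z = dilate (1 / phi z) z"
  unfolding angular_def
proof (rule the_equality)
  note p = phi_pos[OF assms]
  have "phi (dilate (1 / phi z) z) = 1"
    using p by (subst phi_dilate) auto
  moreover have "z = dilate (phi z) (dilate (1 / phi z) z)"
    using p by (simp add: dilate_dilate)
  ultimately show "dilate (1 / phi z) z \<in> Xi \<and> (\<exists>r>0. z = dilate r (dilate (1 / phi z) z))"
    using p by (auto simp: Xi_def)
  fix \<xi> assume "\<xi> \<in> Xi \<and> (\<exists>r>0. z = dilate r \<xi>)"
  then obtain r where r: "r > 0" "z = dilate r \<xi>" "phi \<xi> = 1"
    by (auto simp: Xi_def)
  then have "phi z = r" by (simp add: phi_dilate)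
  with r show "\<xi> = dilate (1 / phi z) z" by (simp add: dilate_dilate)
qed

lemma dilate_neq_0: "r > 0 \<Longrightarrow> z \<noteq> 0 \<Longrightarrow> dilate r z \<noteq> 0"
  by (cases z) (auto simp: zero_prod_def)

lemma act_neq_0: "v \<in> V_T \<Longrightarrow> z \<noteq> 0 \<Longrightarrow> act v z \<noteq> 0"
  using V_T_norm[of v] by (cases z) (auto simp: zero_prod_def)

lemma tau_neq_0: "z \<noteq> 0 \<Longrightarrow> tau z \<noteq> 0"
  by (cases z) (auto simp: zero_prod_def)

lemma angular_dilate: "r > 0 \<Longrightarrow> z \<noteq> 0 \<Longrightarrow> angular (dilate r z) = angular z"
  by (simp add: angular_eq dilate_neq_0 phi_dilate dilate_dilate)

lemma angular_act: "v \<in> V_T \<Longrightarrow> z \<noteq> 0 \<Longrightarrow> angular (act v z) = act v (angular z)"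
  by (simp add: angular_eq act_neq_0 phi_act dilate_act)

lemma angular_tau: "z \<noteq> 0 \<Longrightarrow> angular (tau z) = tau (angular z)"
  by (simp add: angular_eq tau_neq_0 phi_tau tau_dilate)

lemma phi_angular: "z \<noteq> 0 \<Longrightarrow> phi (angular z) = 1"
  using phi_pos[of z] by (simp add: angular_eq phi_dilate)

section \<open>First controls, switching times and their symmetries\<close>

definition tie_gap :: "complex \<Rightarrow> complex \<Rightarrow> complex3 \<Rightarrow> real" where
  "tie_gap u v z = ReIP (u - v) (snd (snd z))"

text \<open>Strict lexicographic maximality, decided already by z3 and z2; the maximal control is
  then unique.\<close>

definition dominates :: "complex3 \<Rightarrow> complex \<Rightarrow> bool" where
  "dominates z u \<longleftrightarrow> u \<in> V_T \<and>
     (\<forall>v\<in>V_T - {u}. ReIP (u - v) (snd (snd z)) > 0 \<or>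
        ReIP (u - v) (snd (snd z)) = 0 \<and> ReIP (u - v) (fst (snd z)) > 0)"

text \<open>A relational form of "first control \<open>u\<close>, first positive switching time
  \<open>T\<close>". Unlike the description operators behind \<open>fuller_poincare\<close>, it can
  be transported along rotations, dilations and time reversal.\<close>

definition switches :: "complex3 \<Rightarrow> complex \<Rightarrow> real \<Rightarrow> bool" where
  "switches z u T \<longleftrightarrow> dominates z u \<and> T > 0 \<and>
     (\<exists>v\<in>V_T - {u}. tie_gap u v (fuller_traj u z T) = 0) \<and>
     (\<forall>t\<in>{0<..<T}. \<forall>v\<in>V_T - {u}. tie_gap u v (fuller_traj u z t) \<noteq> 0)"

lemma ReIP_diff: "ReIP (u - v) z = ReIP z u - ReIP z v"
  by (simp add: ReIP_def algebra_simps)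

lemma first_control_eq:
  assumes "dominates z u"
  shows "first_control z = u"
proof (cases z)
  case (fields z1 z2 z3)
  have u: "u \<in> V_T" using assms by (simp add: dominates_def)
  have gt: "ReIP z3 v < ReIP z3 u \<or> ReIP z3 v = ReIP z3 u \<and> ReIP z2 v < ReIP z2 u"
    if "v \<in> V_T" "v \<noteq> u" for v
    using assms that fields by (fastforce simp: dominates_def ReIP_diff)
  have lex: "lex_maximal z v \<longleftrightarrow> v = u" for v
  proof
    assume "lex_maximal z v"
    then show "v = u"
      using gt[of v] u fields by (fastforce simp: lex_maximal_def)
  next
    assume "v = u"
    then show "lex_maximal z v"
      using gt u fields by (fastforce simp: lex_maximal_def)
  qed
  then show ?thesis
    unfolding first_control_def by (intro the_equality) auto
qed

lemma fuller_poincare_eq: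
  assumes "switches z u T"
  shows "fuller_poincare z = fuller_traj u z T"
proof -
  have u: "first_control z = u"
    using assms first_control_eq by (simp add: switches_def)
  have "switching_time z = T"
    unfolding switching_time_def Let_def u tie_gap_def[symmetric]
  proof (rule Least_equality)
    show "T > 0 \<and> (\<exists>v\<in>V_T - {u}. tie_gap u v (fuller_traj u z T) = 0)"
      using assms by (simp add: switches_def)
  next
    fix t assume "t > 0 \<and> (\<exists>v\<in>V_T - {u}. tie_gap u v (fuller_traj u z t) = 0)"
    then show "T \<le> t"
      using assms by (force simp: switches_def not_le[symmetric])
  qed
  then show ?thesis
    by (simp add: fuller_poincare_def u)
qed

lemma fuller_traj_0: "fuller_traj u z 0 = z"
  by (cases z) (simp add: fuller_traj_eq)

lemma fuller_traj_act: "fuller_traj (v * u) (act v z) t = act v (fuller_traj u z t)"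
  by (cases z) (simp add: fuller_traj_eq Let_def algebra_simps)

lemma fuller_traj_dilate: "fuller_traj u (dilate r z) (r * t) = dilate r (fuller_traj u z t)"
  by (cases z) (simp add: fuller_traj_eq Let_def algebra_simps power2_eq_square power3_eq_cube)

text \<open>Reversing time flips the sign of every derivative; conjugation together with the sign on
  z2 in \<open>tau\<close> restores the Fuller system, now with control
  \<open>cnj u\<close>.\<close>

lemma fuller_traj_tau:
  "fuller_traj (cnj u) (tau (fuller_traj u z T)) t = tau (fuller_traj u z (T - t))"
  by (cases z) (simp add: fuller_traj_eq Let_def algebra_simps power2_eq_square power3_eq_cube
      add_divide_distrib diff_divide_distrib)

lemma ReIP_act: "v \<in> V_T \<Longrightarrow> ReIP (v * u - v * w) (v * z) = ReIP (u - w) z"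
proof -
  assume "v \<in> V_T"
  moreover have "ReIP (v * u - v * w) (v * z) = Re ((cnj v * v) * (cnj (u - w) * z))"
    by (simp add: ReIP_def algebra_simps)
  ultimately show ?thesis by (simp add: V_T_cnj_mult ReIP_def)
qed

lemma tie_gap_act: "v \<in> V_T \<Longrightarrow> tie_gap (v * u) (v * w) (act v z) = tie_gap u w z"
  by (cases z) (simp add: tie_gap_def ReIP_act)

lemma ReIP_of_real: "ReIP u (complex_of_real r * z) = r * ReIP u z"
  by (simp add: ReIP_def algebra_simps)

lemma tie_gap_dilate: "tie_gap u w (dilate r z) = r ^ 3 * tie_gap u w z"
  by (cases z) (simp add: tie_gap_def ReIP_of_real del: of_real_power)

lemma tie_gap_tau: "tie_gap (cnj u) (cnj w) (tau z) = tie_gap u w z"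
  by (cases z) (simp add: tie_gap_def ReIP_def algebra_simps)

lemma dominates_act:
  assumes v: "v \<in> V_T" and "dominates z u"
  shows "dominates (act v z) (v * u)"
  unfolding dominates_def
proof (intro conjI ballI)
  show "v * u \<in> V_T" using assms V_T_mult by (simp add: dominates_def)
  fix w assume "w \<in> V_T - {v * u}"
  then show "ReIP (v * u - w) (snd (snd (act v z))) > 0 \<or>
        ReIP (v * u - w) (snd (snd (act v z))) = 0 \<and> ReIP (v * u - w) (fst (snd (act v z))) > 0"
    by (rule V_T_wlog_mult[OF v, rotated])
       (use assms in \<open>cases z; force simp: dominates_def ReIP_act\<close>)
qed

lemma dominates_dilate: "r > 0 \<Longrightarrow> dominates z u \<Longrightarrow> dominates (dilate r z) u"
  by (cases z) (fastforce simp: dominates_def ReIP_of_real zero_less_mult_iff simp del: of_real_power)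

lemma switches_act:
  assumes v: "v \<in> V_T" and s: "switches z u T"
  shows "switches (act v z) (v * u) T"
  unfolding switches_def
proof (intro conjI ballI)
  show "dominates (act v z) (v * u)" "T > 0"
    using assms dominates_act by (auto simp: switches_def)
  obtain w where "w \<in> V_T - {u}" "tie_gap u w (fuller_traj u z T) = 0"
    using s by (auto simp: switches_def)
  moreover have "v \<noteq> 0" using V_T_norm[OF v] by auto
  ultimately show "\<exists>w\<in>V_T - {v * u}. tie_gap (v * u) w (fuller_traj (v * u) (act v z) T) = 0"
    using v by (intro bexI[of _ "v * w"]) (auto simp: fuller_traj_act tie_gap_act V_T_mult)
  fix t w assume t: "t \<in> {0<..<T}" and "w \<in> V_T - {v * u}"
  show "tie_gap (v * u) w (fuller_traj (v * u) (act v z) t) \<noteq> 0"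
    by (rule V_T_wlog_mult[OF v _ \<open>w \<in> V_T - {v * u}\<close>])
       (use s v t in \<open>auto simp: fuller_traj_act tie_gap_act switches_def\<close>)
qed

lemma switches_dilate:
  assumes r: "r > 0" and s: "switches z u T"
  shows "switches (dilate r z) u (r * T)"
  unfolding switches_def
proof (intro conjI ballI)
  show "dominates (dilate r z) u"
    using assms dominates_dilate by (simp add: switches_def)
  show "r * T > 0" using assms by (simp add: switches_def)
  show "\<exists>w\<in>V_T - {u}. tie_gap u w (fuller_traj u (dilate r z) (r * T)) = 0"
    using s by (auto simp: fuller_traj_dilate tie_gap_dilate switches_def)
  fix t w assume t: "t \<in> {0<..<r * T}" and w: "w \<in> V_T - {u}"
  then have "t / r \<in> {0<..<T}" using r by (simp add: field_simps)
  then have "tie_gap u w (fuller_traj u (dilate r z) (r * (t / r))) \<noteq> 0"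
    using s w r unfolding fuller_traj_dilate tie_gap_dilate by (simp add: switches_def)
  then show "tie_gap u w (fuller_traj u (dilate r z) t) \<noteq> 0" using r by simp
qed

text \<open>The reversed trajectory passes the same points backwards, so the absence of ties in
  between is inherited and a tie at the start \<open>z\<close> becomes the switching. Which control
  is chosen at the new starting point does not follow from the forward motion, hence the assumption
  \<open>dom\<close>.\<close>

lemma switches_tau:
  assumes s: "switches z u T" and dom: "dominates (tau (fuller_traj u z T)) (cnj u)"
    and tie: "v \<in> V_T - {u}" "tie_gap u v z = 0"
  shows "switches (tau (fuller_traj u z T)) (cnj u) T"
  unfolding switches_def
proof (intro conjI ballI)
  show "T > 0" using s by (simp add: switches_def)
  then show "\<exists>w\<in>V_T - {cnj u}.
      tie_gap (cnj u) w (fuller_traj (cnj u) (tau (fuller_traj u z T)) T) = 0"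
    using tie V_T_cnj by (intro bexI[of _ "cnj v"]) (auto simp: fuller_traj_tau tie_gap_tau fuller_traj_0)
  fix t w assume t: "t \<in> {0<..<T}" and w: "w \<in> V_T - {cnj u}"
  then have "T - t \<in> {0<..<T}" "cnj w \<in> V_T - {u}" using V_T_cnj by auto
  then have "tie_gap u (cnj w) (fuller_traj u z (T - t)) \<noteq> 0"
    using s by (simp add: switches_def)
  then show "tie_gap (cnj u) w (fuller_traj (cnj u) (tau (fuller_traj u z T)) t) \<noteq> 0"
    using tie_gap_tau[of u "cnj w"] by (simp add: fuller_traj_tau)
qed (rule dom)

text \<open>Every element of the orbit is a rotated dilate of \<open>z\<close>, so equivariance
  makes all members of the union in \<open>F_ang\<close> the same orbit. One step can thus be
  computed from an unnormalised representative.\<close>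

lemma F_ang_VT_orbit:
  assumes s: "switches z u T" and z: "z \<noteq> 0" and fin: "fuller_traj u z T \<noteq> 0"
  shows "F_ang (VT_orbit (angular z)) = VT_orbit (angular (fuller_traj u z T))"
proof -
  define c where "c = 1 / phi z"
  have c: "c > 0" using phi_pos[OF z] by (simp add: c_def)
  have "fuller_poincare (act v (dilate c z)) = act v (dilate c (fuller_traj u z T))"
    if "v \<in> V_T" for v
    using fuller_poincare_eq[OF switches_act[OF that switches_dilate[OF c s]]]
    by (simp add: fuller_traj_act fuller_traj_dilate)
  then have "VT_orbit (angular (fuller_poincare (act v (angular z))))
      = VT_orbit (angular (fuller_traj u z T))" if "v \<in> V_T" for v
    using that c fin
    by (simp add: angular_eq[OF z] c_def[symmetric] angular_act angular_dilate dilate_neq_0 VT_orbit_act)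
  then show ?thesis
    using V_T_elements(1) unfolding F_ang_def VT_orbit_def[of "angular z"] by auto
qed

section \<open>A chart near the fixed points\<close>

text \<open>
  The action of \<open>V_T\<close> makes \<open>z3\<close> a negative real, the dilation makes \<open>Re z1 = -1\<close>, and
  vanishing of the Hamiltonian then determines \<open>z3\<close>.
\<close>

definition chart :: "real \<times> real \<times> real \<Rightarrow> complex3" where
  "chart = (\<lambda>(a, b, y).
     (Complex (- 1) (a / sqrt 3), Complex (b / sqrt 3) y, complex_of_real (2 * (y + a * b / 3))))"

lemma chart_neq_0: "chart x \<noteq> 0"
  by (cases x) (auto simp: chart_def zero_prod_def complex_eq_iff)

text \<open>For real z3 = c <= 0 the controls \<open>zeta\<close> and \<open>zeta\<^sup>2\<close>
  tie with value -c/2, which is at least the value c of the control 1.\<close>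

lemma hamiltonian_vanishes_iff:
  assumes "c \<le> 0"
  shows "hamiltonian_vanishes (z1, z2, complex_of_real c) \<longleftrightarrow> c = - 2 * Im (cnj z1 * z2)"
proof -
  let ?h = "ReIP z1 (\<i> * z2)"
  have "H_F (z1, z2, of_real c) ` V_T = {?h + c, ?h - c / 2}"
    unfolding V_T_def zeta_power2_eq by (auto simp: zeta_eq ReIP_def)
  moreover have "max (?h + c) (?h - c / 2) = ?h - c / 2"
    using assms by simp
  ultimately have "hamiltonian_vanishes (z1, z2, of_real c) \<longleftrightarrow> ?h - c / 2 = 0"
    by (simp add: hamiltonian_vanishes_def)
  then show ?thesis by (simp add: ReIP_def) argo
qed

lemma hamiltonian_vanishes_act:
  assumes "v \<in> V_T"
  shows "hamiltonian_vanishes (act v z) \<longleftrightarrow> hamiltonian_vanishes z"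
proof (cases z)
  case (fields z1 z2 z3)
  have R: "ReIP (v * p) (v * q) = ReIP p q" for p q
    using ReIP_act[OF assms, of p 0 q] by simp
  have "H_F (act v z) (v * u) = H_F z u" for u
    using R[of z1 "\<i> * z2"] R[of u z3] fields by (simp add: mult.left_commute)
  then have "H_F (act v z) ` (*) v ` V_T = H_F z ` V_T"
    by (simp add: image_image)
  then show ?thesis
    by (simp add: mult_V_T_image[OF assms] hamiltonian_vanishes_def)
qed

lemma walls_act:
  assumes "v \<in> V_T" "w \<in> walls"
  shows "v * w \<in> walls"
proof -
  obtain x u where "w = complex_of_real x * u" "x \<le> 0" "u \<in> V_T"
    using assms by (auto simp: walls_def)
  then have "v * w = complex_of_real x * (v * u)" "v * u \<in> V_T"
    using assms V_T_mult by auto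
  then show ?thesis using \<open>x \<le> 0\<close> unfolding walls_def by blast
qed

text \<open>The other two rays point along \<open>- zeta\<close> and \<open>- zeta\<^sup>2\<close>,
  whose real part is 1/2.\<close>

lemma walls_Re_neg:
  assumes "w \<in> walls" "Re w < 0"
  shows "w = complex_of_real (Re w)"
  using assms unfolding walls_def V_T_def zeta_power2_eq
  by (auto simp: zeta_eq complex_eq_iff mult_less_0_iff)

lemma walls_dilate:
  assumes "r \<ge> 0" "w \<in> walls"
  shows "complex_of_real r * w \<in> walls"
proof -
  obtain x u where "w = complex_of_real x * u" "x \<le> 0" "u \<in> V_T"
    using assms by (auto simp: walls_def)
  then have "complex_of_real r * w = complex_of_real (r * x) * u" "r * x \<le> 0"
    using assms by (auto simp: mult_nonneg_nonpos)
  then show ?thesis using \<open>u \<in> V_T\<close> unfolding walls_def by blast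
qed

lemma Xi_W0_act:
  assumes "v \<in> V_T" "\<xi> \<in> Xi_W0"
  shows "act v \<xi> \<in> Xi_W0"
  using assms walls_act hamiltonian_vanishes_act phi_act
  by (cases \<xi>) (auto simp: Xi_W0_def Xi_W_def Xi_def simp del: phi.simps)

lemma hamiltonian_vanishes_dilate:
  assumes r: "r > 0" and z: "hamiltonian_vanishes z"
  shows "hamiltonian_vanishes (dilate r z)"
proof (cases z)
  case (fields z1 z2 z3)
  have "H_F (dilate r z) u = r ^ 3 * H_F z u" for u
    unfolding fields by (simp add: ReIP_def power2_eq_square power3_eq_cube algebra_simps)
  then have "H_F (dilate r z) ` V_T = (*) (r ^ 3) ` (H_F z ` V_T)"
    by (simp add: image_image)
  moreover have "r ^ 3 * Max (H_F z ` V_T) = Max ((*) (r ^ 3) ` (H_F z ` V_T))"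
    using r by (intro mono_Max_commute monoI mult_left_mono) (auto simp: V_T_def)
  ultimately show ?thesis
    using z by (simp add: hamiltonian_vanishes_def)
qed

text \<open>The last condition puts z3 of the chart point on the open negative real axis.
  \<open>y > 0\<close> decides the tie there for \<open>zeta\<close>, and together with
  \<open>a > 0\<close> it keeps the gap to \<open>zeta\<^sup>2\<close> positive afterwards.\<close>

definition admissible :: "real \<times> real \<times> real \<Rightarrow> bool" where
  "admissible = (\<lambda>(a, b, y). a > 0 \<and> y > 0 \<and> y + a * b / 3 < 0)"

lemma angular_chart_in_Xi_W0:
  assumes "admissible x"
  shows "angular (chart x) \<in> Xi_W0"
proof -
  obtain a b y where x: "x = (a, b, y)" by (cases x)
  define r where "r = 1 / phi (chart x)"
  have r: "r > 0" using phi_pos[OF chart_neq_0] by (simp add: r_def)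
  have "hamiltonian_vanishes (chart x)"
    using assms unfolding x chart_def prod.case
    by (subst hamiltonian_vanishes_iff) (auto simp: admissible_def)
  moreover have "snd (snd (chart x)) \<in> walls"
    using assms V_T_elements(1) unfolding x walls_def chart_def admissible_def prod.case snd_conv
    by (intro CollectI exI[of _ "2 * (y + a * b / 3)"] exI[of _ 1]) auto
  then have "snd (snd (dilate r (chart x))) \<in> walls"
    using r by (cases "chart x") (auto intro!: walls_dilate simp del: of_real_power)
  ultimately show ?thesis
    using r phi_angular[OF chart_neq_0]
    by (auto simp: Xi_W0_def Xi_W_def Xi_def angular_eq[OF chart_neq_0] r_def hamiltonian_vanishes_dilate)
qed

text \<open>On the negative real axis \<open>zeta\<close> and \<open>zeta\<^sup>2\<close> tie and
  beat 1; the sign of \<open>Im z2\<close> decides between them.\<close>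

lemma dominates_zeta:
  assumes "c < 0" "Im z2 > 0"
  shows "dominates (z1, z2, complex_of_real c) zeta"
  using assms unfolding dominates_def V_T_def zeta_power2_eq by (auto simp: zeta_eq ReIP_def)

lemma dominates_chart:
  assumes "admissible x"
  shows "dominates (chart x) zeta" "dominates (tau (chart x)) zeta"
proof -
  obtain a b y where x: "x = (a, b, y)" by (cases x)
  show "dominates (chart x) zeta" "dominates (tau (chart x)) zeta"
    using assms unfolding x chart_def prod.case tau.simps complex_cnj_complex_of_real
    by (intro dominates_zeta; simp add: admissible_def)+
qed

lemma fuller_traj_chart:
  "fuller_traj zeta (chart (a, b, y)) (sqrt 3 * t) =
    (Complex (- 1 + 3 / 2 * t) ((a / 3 + t / 2) * sqrt 3),
     Complex ((b - 3 * t + 9 / 4 * t ^ 2) / 3 * sqrt 3) (y + a * t + 3 / 4 * t ^ 2),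
     Complex (2 * (y + a * b / 3) + b * t - 3 / 2 * t ^ 2 + 3 / 4 * t ^ 3)
       ((y * t + a / 2 * t ^ 2 + t ^ 3 / 4) * sqrt 3))"
proof -
  \<comment> \<open>The root is hidden behind a symbol, so that it is reduced only through
    \<open>s * s = 3\<close>.\<close>
  define s where "s = sqrt 3"
  have s: "s * s = 3" "s \<noteq> 0" by (auto simp: s_def)
  have s2: "s\<^sup>2 = 3" "s ^ 3 = 3 * s" using s(1) by (simp_all add: power2_eq_square power3_eq_cube)
  have s3: "s * (s * x) = 3 * x" "(s * x)\<^sup>2 = 3 * x\<^sup>2" "(s * x) ^ 3 = 3 * (s * x ^ 3)" for x
    using s(1) by (simp_all add: mult.assoc[symmetric] power2_eq_square power3_eq_cube)
  have d: "x / s = x / 3 * s" for x using s by (simp add: field_simps)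
  show ?thesis
    unfolding zeta_eq chart_def prod.case fuller_traj_eq Let_def s_def[symmetric] d prod.inject
    apply (intro conjI complex_eqI)
    apply (simp_all add: s(1))
  proof -
    show "a * s / 3 + s * t / 2 = (a / 3 + t / 2) * s"
      by (simp add: algebra_simps)
    show "b * s - s * t * 3 + s * (s * t)\<^sup>2 * 3 / 4 = (b - 3 * t + 9 * t\<^sup>2 / 4) * s"
      by (simp add: s(1) s2 s3 algebra_simps)
    show "a * s * (s * t) / 3 + (s * t)\<^sup>2 / 4 = a * t + 3 * t\<^sup>2 / 4"
      by (simp add: s(1) s2 s3 algebra_simps)
    show "b * s * (s * t) / 3 + (s * (s * t) ^ 3 / 12 - (s * t)\<^sup>2 / 2) =
      b * t + (3 * t ^ 3 / 4 - 3 * t\<^sup>2 / 2)"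
      by (simp add: s(1) s2 s3 algebra_simps)
    show "y * (s * t) + a * s * (s * t)\<^sup>2 / 6 + (s * t) ^ 3 / 12 =
      (y * t + a * t\<^sup>2 / 2 + t ^ 3 / 4) * s"
      by (simp add: s(1) s2 s3 algebra_simps)
  qed
qed

text \<open>Descartes' rule: for t > 0 the equation reads 1 = p/t + q/t^2 + c/t^3 with positive p,
  q, c, and the right side is strictly decreasing. Cross-multiplying two instances gives the
  factorisation below.\<close>

lemma switch_poly_root_unique:
  assumes adm: "admissible (a, b, y)" and "b < y"
    and s: "s > 0" "switch_poly a b y s = 0" and t: "t > 0" "switch_poly a b y t = 0"
  shows "s = t"
proof -
  define p q c where "p = 3 + a" and "q = 2 * (y - b)" and "c = - 4 * (y + a * b / 3)"
  have pos: "p > 0" "q > 0" "c > 0"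
    using adm \<open>b < y\<close> by (auto simp: admissible_def p_def q_def c_def)
  have "s ^ 3 = p * s ^ 2 + q * s + c" "t ^ 3 = p * t ^ 2 + q * t + c"
    using s t unfolding switch_poly_def p_def q_def c_def by algebra+
  then have "(s - t) * (p * (s ^ 2 * t ^ 2) + q * (s * t * (s + t)) + c * (s ^ 2 + s * t + t ^ 2)) = 0"
    by algebra
  moreover have "p * (s ^ 2 * t ^ 2) + q * (s * t * (s + t)) + c * (s ^ 2 + s * t + t ^ 2) > 0"
    using pos s t by (intro add_pos_pos mult_pos_pos) auto
  ultimately show ?thesis by auto
qed

lemma cube_bounds:
  assumes "(a, b, y) \<in> cube e" "e \<le> 1/100"
  shows "71/100 \<le> a" "a \<le> 74/100" "- (1003/1000) \<le> b" "b \<le> - (98/100)"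
    "12/100 \<le> y" "y \<le> 143/1000"
  using assms base_bounds unfolding cube_def by (auto simp: abs_less_iff)

lemma cube_admissible:
  assumes "x \<in> cube e" "e \<le> 1/100"
  shows "admissible x"
proof -
  obtain a b y where x: "x = (a, b, y)" by (cases x)
  note B = cube_bounds[OF assms(1)[unfolded x] assms(2)]
  have "71/100 * (98/100) \<le> a * (- b)"
    using B by (intro mult_mono) auto
  then show ?thesis using B unfolding x admissible_def by simp
qed

lemma switch_poly_root_exists:
  assumes "(a, b, y) \<in> cube e" "e \<le> 1/100"
  obtains t where "t > 0" "switch_poly a b y t = 0"
proof -
  note B = cube_bounds[OF assms]
  have adm: "y + a * b / 3 < 0"
    using cube_admissible[OF assms] by (simp add: admissible_def)
  have K0: "switch_poly a b y 0 < 0"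
    using adm by (simp add: switch_poly_def)
  have "a * (- b) \<le> 74/100 * (1003/1000)"
    using B by (intro mult_mono) auto
  then have K10: "switch_poly a b y 10 > 0"
    using B by (simp add: switch_poly_def)
  have "continuous_on {0..10} (switch_poly a b y)"
    unfolding switch_poly_def by (intro continuous_intros)
  then have "\<exists>t\<ge>0. t \<le> 10 \<and> switch_poly a b y t = 0"
    using less_imp_le[OF K0] less_imp_le[OF K10] by (intro IVT') simp_all
  then obtain t where t: "t \<ge> 0" "switch_poly a b y t = 0"
    by blast
  with K0 have "t \<noteq> 0" by (metis less_irrefl)
  with t show ?thesis using that[of t] by simp
qed

lemma tie_gap_chart:
  "tie_gap zeta (zeta\<^sup>2) (fuller_traj zeta (chart (a, b, y)) (sqrt 3 * t)) =
     3 * (y * t + a / 2 * t ^ 2 + t ^ 3 / 4)"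
  "tie_gap zeta 1 (fuller_traj zeta (chart (a, b, y)) (sqrt 3 * t)) = - 3 / 4 * switch_poly a b y t"
proof -
  have s: "sqrt 3 * (x * sqrt 3) = 3 * x" for x by simp
  show "tie_gap zeta (zeta\<^sup>2) (fuller_traj zeta (chart (a, b, y)) (sqrt 3 * t)) =
     3 * (y * t + a / 2 * t ^ 2 + t ^ 3 / 4)"
    unfolding fuller_traj_chart tie_gap_def ReIP_def snd_conv
    unfolding zeta_power2_eq unfolding zeta_eq by (simp add: s)
  show "tie_gap zeta 1 (fuller_traj zeta (chart (a, b, y)) (sqrt 3 * t)) = - 3 / 4 * switch_poly a b y t"
    unfolding fuller_traj_chart tie_gap_def ReIP_def snd_conv
    unfolding zeta_eq switch_poly_def by (simp add: s) (simp add: field_simps)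
qed

lemma switches_chart:
  assumes adm: "admissible (a, b, y)" and "b < y" and t: "t > 0" "switch_poly a b y t = 0"
  shows "switches (chart (a, b, y)) zeta (sqrt 3 * t)"
  unfolding switches_def
proof (intro conjI ballI)
  show "dominates (chart (a, b, y)) zeta" by (rule dominates_chart[OF adm])
  show "sqrt 3 * t > 0" using t by simp
  have "tie_gap zeta 1 (fuller_traj zeta (chart (a, b, y)) (sqrt 3 * t)) = 0"
    unfolding tie_gap_chart using t by simp
  then show "\<exists>v\<in>V_T - {zeta}. tie_gap zeta v (fuller_traj zeta (chart (a, b, y)) (sqrt 3 * t)) = 0"
    using V_T_elements V_T_distinct by (intro bexI[of _ 1]) auto
  fix s v assume s: "s \<in> {0<..<sqrt 3 * t}" and v: "v \<in> V_T - {zeta}"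
  define s' where "s' = s / sqrt 3"
  have s': "0 < s'" "s' < t" "s = sqrt 3 * s'"
    using s by (auto simp: s'_def pos_divide_less_eq mult.commute)
  have "switch_poly a b y s' \<noteq> 0"
    using switch_poly_root_unique[OF adm \<open>b < y\<close> _ _ t, of s'] s' by auto
  moreover have "y * s' + a / 2 * s' ^ 2 + s' ^ 3 / 4 > 0"
    using adm s' by (auto simp: admissible_def intro!: add_pos_pos)
  moreover have "v = 1 \<or> v = zeta\<^sup>2"
    using v by (auto simp: V_T_def)
  ultimately show "tie_gap zeta v (fuller_traj zeta (chart (a, b, y)) s) \<noteq> 0"
    unfolding s'(3) by (auto simp: tie_gap_chart)
qed

text \<open>A tie of \<open>zeta\<close> with 1 places z3 on the real line through
  \<open>zeta\<^sup>2\<close>, which multiplication by \<open>zeta\<close> turns into the real axis.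
  The new z1 has real part \<open>- D / 2\<close>, and dividing out this dilation gives chart form
  again.\<close>

lemma act_zeta_traj_chart:
  assumes K: "switch_poly a b y t = 0" and D: "D = 3 * t + a - 1"
    and ab: "D * a' = 3 * t - 3 - a"
      "D ^ 2 * b' = - 2 * (b + 3 * y + 3 * (a - 1) * t + 9 / 2 * t ^ 2)"
      "D ^ 2 * y' = 2 * (b - y - (3 + a) * t + 3 / 2 * t ^ 2)"
  shows "act zeta (fuller_traj zeta (chart (a, b, y)) (sqrt 3 * t)) = dilate (D / 2) (chart (a', b', y'))"
proof -
  define s where "s = sqrt 3"
  have s: "s * s = 3" "s \<noteq> 0" by (auto simp: s_def)
  have s2: "s\<^sup>2 = 3" "s ^ 3 = 3 * s" using s(1) by (simp_all add: power2_eq_square power3_eq_cube)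
  have s3: "s * (s * x) = 3 * x" "(s * x)\<^sup>2 = 3 * x\<^sup>2" "(s * x) ^ 3 = 3 * (s * x ^ 3)" for x
    using s(1) by (simp_all add: mult.assoc[symmetric] power2_eq_square power3_eq_cube)
  have d: "x / s = x / 3 * s" for x using s by (simp add: field_simps)
  show ?thesis
    unfolding fuller_traj_chart
    unfolding chart_def prod.case act.simps dilate.simps prod.inject zeta_eq s_def[symmetric] d
    apply (intro conjI complex_eqI)
    apply (simp_all add: power_divide s(2) del: of_real_power)
  proof -
    show "- ((3 * t / 2 - 1) / 2) - s * ((a / 3 + t / 2) * s) / 2 = - (D / 2)"
    proof -
      have "s * ((a / 3 + t / 2) * s) = (a / 3 + t / 2) * (s * s)" by simp
      then show ?thesis using D s(1) by (simp add: field_simps)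
    qed
    show "3 * (s * (3 * t / 2 - 1)) - 3 * (s * (a / 3 + t / 2)) = D * (a' * s)"
      using ab(1) by algebra
    show "- (2 * (s * (b - 3 * t + 9 * t\<^sup>2 / 4))) -
    6 * (s * (y + a * t + 3 * t\<^sup>2 / 4)) = D\<^sup>2 * (b' * s)"
      using ab(2) by algebra
    show "2 * (s * (s * (b - 3 * t + 9 * t\<^sup>2 / 4))) / 3 -
    (y * 4 + a * t * 4 + 3 * t\<^sup>2) / 2 =  D\<^sup>2 * y'"
      unfolding ab s3 by (simp add: field_simps)
    \<comment> \<open>The real part of z3: \<open>D ^ 3\<close> is distributed to match the three
      given products, and the switching equation then identifies the two sides.\<close>
    have "D ^ 3 * (2 * y' + 2 * (a' * b') / 3) = 2 * (D * (D ^ 2 * y')) + 2 * ((D * a') * (D ^ 2 * b')) / 3"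
      by algebra
    also have "\<dots> = - ((16 * y + 16 * (a * b) / 3 + b * t * 8 - 12 * t\<^sup>2 + 6 * t ^ 3) / 2) -
      12 * (y * t + a * t\<^sup>2 / 2 + t ^ 3 / 4)"
      unfolding ab using K unfolding switch_poly_def D by algebra
    finally show "- ((16 * y + 16 * (a * b) / 3 + b * t * 8 - 12 * t\<^sup>2 + 6 * t ^ 3) / 2) -
      4 * (s * (s * (y * t + a * t\<^sup>2 / 2 + t ^ 3 / 4))) =
      D ^ 3 * (2 * y' + 2 * (a' * b') / 3)"
      by (simp add: s3)
    \<comment> \<open>The vanishing imaginary part of z3 is half the switching equation.\<close>
    show "2 * y + 2 * (a * b) / 3 + b * t - 3 * t\<^sup>2 / 2 + 3 * t ^ 3 / 4 =
     y * t + a * t\<^sup>2 / 2 + t ^ 3 / 4"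
      using K unfolding switch_poly_def by algebra
  qed
qed

section \<open>One step of the angular map, forwards and reversed\<close>

definition chart_orbit :: "real \<times> real \<times> real \<Rightarrow> complex3 set" where
  "chart_orbit x = VT_orbit (angular (chart x))"

text \<open>A single arc gives both equations: followed forwards it leads from \<open>x\<close> to
  \<open>x'\<close>, and its image under \<open>tau\<close> leads from \<open>tau\<close> of
  \<open>x'\<close> to \<open>tau\<close> of \<open>x\<close>.\<close>

lemma F_ang_step:
  assumes x: "x \<in> cube e" and e: "e \<le> 1/100"
  obtains x' where "x' \<in> cube (e / 2)" "F_ang (chart_orbit x) = chart_orbit x'"
    "F_ang (tau ` chart_orbit x') = tau ` chart_orbit x"
proof -
  obtain a b y where abc: "x = (a, b, y)" by (cases x)
  note cube = x[unfolded abc]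
  obtain t where t: "t > 0" "switch_poly a b y t = 0"
    using switch_poly_root_exists[OF cube e] .
  define D where "D = 3 * t + a - 1"
  define x' where "x' = ((3 * t - 3 - a) / D,
          - 2 * (b + 3 * y + 3 * (a - 1) * t + 9 / 2 * t ^ 2) / D ^ 2,
          2 * (b - y - (3 + a) * t + 3 / 2 * t ^ 2) / D ^ 2)"
  have D: "D > 12" and x': "x' \<in> cube (e / 2)"
    unfolding x'_def using cube_contraction[OF cube e t D_def] by auto
  have "e > 0" using cube by (auto simp: cube_def)
  then have adm: "admissible x" "admissible x'"
    using cube_admissible[OF x e] cube_admissible[OF x'] e by auto
  define w where "w = fuller_traj zeta (chart x) (sqrt 3 * t)"
  have sw: "switches (chart x) zeta (sqrt 3 * t)"
    using switches_chart[of a b y t] adm(1) cube_bounds[OF cube e] t by (simp add: abc)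
  have w: "act zeta w = dilate (D / 2) (chart x')"
    unfolding w_def abc x'_def using D
    by (intro act_zeta_traj_chart[OF t(2) D_def]) (simp_all only: times_divide_eq_right
        nonzero_mult_div_cancel_left power_not_zero less_imp_neq[symmetric] not_False_eq_True
        zero_less_numeral less_trans[of 0 12 D])
  have w0: "w \<noteq> 0"
  proof
    assume "w = 0"
    then have "dilate (D / 2) (chart x') = 0" unfolding w[symmetric] by (simp add: zero_prod_def)
    then show False using D dilate_neq_0[OF _ chart_neq_0, of "D / 2" x'] by simp
  qed
  have "VT_orbit (angular w) = VT_orbit (angular (act zeta w))"
    using V_T_elements(2) by (simp add: angular_act w0 VT_orbit_act)
  also have "\<dots> = chart_orbit x'"
    unfolding w using D by (simp add: angular_dilate chart_neq_0 chart_orbit_def)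
  finally have orb: "VT_orbit (angular w) = chart_orbit x'" .
  have "F_ang (chart_orbit x) = chart_orbit x'"
    using F_ang_VT_orbit[OF sw chart_neq_0] w0 orb by (simp add: w_def chart_orbit_def)
  moreover have "F_ang (tau ` chart_orbit x') = tau ` chart_orbit x"
  proof -
    \<comment> \<open>Up to rotation by \<open>zeta\<close> and dilation, the start of the reversed
      arc is \<open>tau\<close> of a chart point, where \<open>zeta\<close> dominates. Hence
      \<open>zeta * zeta = cnj zeta\<close> dominates at \<open>tau w\<close>.\<close>
    have "tau w = act zeta (tau (act zeta w))"
      using V_T_cnj_mult[OF V_T_elements(2)] by (simp add: tau_act act_act mult.commute)
    also have "\<dots> = act zeta (dilate (D / 2) (tau (chart x')))"
      by (simp add: w tau_dilate)
    finally have "tau w = act zeta (dilate (D / 2) (tau (chart x')))" .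
    moreover have "dominates (dilate (D / 2) (tau (chart x'))) zeta"
      using D by (intro dominates_dilate dominates_chart adm) simp
    ultimately have "dominates (tau w) (zeta * zeta)"
      using dominates_act[OF V_T_elements(2)] by simp
    then have dom: "dominates (tau w) (cnj zeta)"
      by (simp add: cnj_zeta power2_eq_square)
    \<comment> \<open>The chart point itself lies on a wall; this tie is what ends the reversed
      arc.\<close>
    have tie: "tie_gap zeta (zeta\<^sup>2) (chart x) = 0"
      using tie_gap_chart(1)[of a b y 0] by (simp add: abc fuller_traj_0)
    have "switches (tau w) (cnj zeta) (sqrt 3 * t)"
      unfolding w_def
      by (rule switches_tau[OF sw dom[unfolded w_def] _ tie]) (use V_T_elements V_T_distinct in auto)
    moreover have "fuller_traj (cnj zeta) (tau w) (sqrt 3 * t) = tau (chart x)"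
      unfolding w_def fuller_traj_tau by (simp add: fuller_traj_0)
    ultimately have "F_ang (VT_orbit (angular (tau w))) = VT_orbit (angular (tau (chart x)))"
      using F_ang_VT_orbit[of "tau w" "cnj zeta" "sqrt 3 * t"] w0 by (simp add: tau_neq_0 chart_neq_0)
    then show ?thesis
      using w0 by (simp add: angular_tau chart_neq_0 chart_orbit_def tau_VT_orbit[symmetric] orb)
  qed
  ultimately show ?thesis using that x' by blast
qed

section \<open>Neighbourhoods in the quotient and stability\<close>

text \<open>Only the third component needs work: modulo the sextic its numerator acquires the factor
  \<open>1 + r ^ 3 + r ^ 6\<close>, which cancels against the denominator.\<close>

lemma z_out_eq_chart: "z_out = chart (a_out, b_out, y_out)"
proof -
  let ?r = r_out
  let ?p = "1 + ?r - 4 * ?r ^ 3 - 7 * ?r ^ 4 - 9 * ?r ^ 5 - 7 * ?r ^ 6 - 4 * ?r ^ 7 + ?r ^ 9 + ?r ^ 10"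
  let ?q = "9 * (1 + ?r) ^ 2 * (1 - ?r + ?r ^ 2) * (1 + ?r ^ 3 + ?r ^ 6)"
  have r: "?r > 0" using r_out(2) by simp
  have nz: "?r + 1 \<noteq> 0" "?r ^ 3 + 1 \<noteq> 0" "1 + ?r ^ 3 + ?r ^ 6 \<noteq> 0"
    using r by (auto simp: add_eq_0_iff_both_eq_0 add_pos_pos less_imp_neq[symmetric])
  have p: "?p = 6 * ?r * (1 + ?r + ?r ^ 2) * (1 + ?r ^ 3 + ?r ^ 6)"
    using r_out(1) unfolding sextic_def by algebra
  have q: "?q = 9 * (?r + 1) * (?r ^ 3 + 1) * (1 + ?r ^ 3 + ?r ^ 6)"
    by algebra
  have y: "y_out = (1 - 3 * ?r - 2 * ?r ^ 2 - 3 * ?r ^ 3 + ?r ^ 4) / (3 * ((?r + 1) * (?r ^ 3 + 1)))"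
    using base_denoms(2) r_out_nz by (simp add: nonzero_eq_divide_eq)
  have "- 2 * ?p / ?q = - 4 * (?r * (1 + ?r + ?r ^ 2)) / (3 * ((?r + 1) * (?r ^ 3 + 1)))"
    unfolding p q using nz by (simp add: divide_simps)
  also have "\<dots> = 2 * (y_out + a_out * b_out / 3)"
    unfolding y a_out_def b_out_def using nz by (simp add: divide_simps) algebra
  finally have c: "- 2 * ?p / ?q = 2 * (y_out + a_out * b_out / 3)" .
  have a: "(- 1 + ?r) / (sqrt 3 * (1 + ?r)) = a_out / sqrt 3"
    and b: "- ((- 1 + ?r ^ 3) / (sqrt 3 * (1 + ?r ^ 3))) = b_out / sqrt 3"
    by (simp_all add: a_out_def b_out_def add.commute mult.commute minus_divide_left)
  show ?thesis
    unfolding z_out_def chart_def Let_def prod.case a b c y_out_def ..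
qed

lemma q_out_eq: "q_out = chart_orbit (a_out, b_out, y_out)"
  by (simp add: q_out_def chart_orbit_def z_out_eq_chart)

lemma base_in_cube: "e > 0 \<Longrightarrow> (a_out, b_out, y_out) \<in> cube e"
  by (simp add: cube_def)

lemma q_out_in_cube: "e > 0 \<Longrightarrow> q_out \<in> chart_orbit ` cube e"
  unfolding q_out_eq by (intro imageI base_in_cube)

lemma cube_mono: "d \<le> e \<Longrightarrow> cube d \<subseteq> cube e"
  by (auto simp: cube_def)

text \<open>The normalisations of the chart undo the two quotients: a negative real z3 forces the
  rotation to be 1, and \<open>Re z1 = -1\<close> then forces equal dilation factors.\<close>

lemma chart_orbit_inj:
  assumes eq: "chart_orbit x = chart_orbit x'" and adm: "admissible x'"
  shows "x = x'"
proof -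
  obtain a b y a' b' y' where x: "x = (a, b, y)" "x' = (a', b', y')"
    by (cases x, cases x') 
  define c c' where "c = 2 * (y + a * b / 3)" and "c' = 2 * (y' + a' * b' / 3)"
  have chart: "chart x = (Complex (- 1) (a / sqrt 3), Complex (b / sqrt 3) y, complex_of_real c)"
    "chart x' = (Complex (- 1) (a' / sqrt 3), Complex (b' / sqrt 3) y', complex_of_real c')"
    by (simp_all add: x chart_def c_def c'_def)
  have c': "c' < 0" using adm by (simp add: x admissible_def c'_def)
  define r r' where "r = 1 / phi (chart x)" and "r' = 1 / phi (chart x')"
  have r: "r > 0" "r' > 0" using phi_pos[OF chart_neq_0] by (auto simp: r_def r'_def)
  obtain v where v: "v \<in> V_T" and "dilate r (chart x) = act v (dilate r' (chart x'))"
    using eq unfolding chart_orbit_def VT_orbit_eq_iff angular_eq[OF chart_neq_0] r_def r'_def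
    by auto
  then have e: "of_real r * Complex (- 1) (a / sqrt 3) = v * (of_real r' * Complex (- 1) (a' / sqrt 3))"
    "of_real (r ^ 2) * Complex (b / sqrt 3) y = v * (of_real (r' ^ 2) * Complex (b' / sqrt 3) y')"
    "complex_of_real (r ^ 3) * of_real c = v * (of_real (r' ^ 3) * of_real c')"
    unfolding chart by auto
  have "Im v * (r' ^ 3 * c') = 0"
    using arg_cong[OF e(3), of Im] by (simp flip: of_real_mult)
  then have "Im v = 0" using r c' by simp
  then have v1: "v = 1" using v unfolding V_T_def zeta_power2_eq by (auto simp: zeta_eq)
  have rr: "r = r'" using arg_cong[OF e(1), of Re] by (simp add: v1)
  show ?thesis
    using e r unfolding v1 rr x by (auto simp: complex_eq_iff)
qed

lemma cube_neighbourhood: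
  assumes S: "open S" and "(a_out, b_out, y_out) \<in> S"
  obtains e where "0 < e" "e \<le> 1/100" "cube e \<subseteq> S"
proof -
  obtain d where d: "d > 0" "ball (a_out, b_out, y_out) d \<subseteq> S"
    using assms open_contains_ball by blast
  define e where "e = min (1/100) (d / 3)"
  have "cube e \<subseteq> ball (a_out, b_out, y_out) d"
  proof
    fix x assume x: "x \<in> cube e"
    obtain a b y where abc: "x = (a, b, y)" by (cases x)
    have "\<bar>a - a_out\<bar> < d / 3" "\<bar>b - b_out\<bar> < d / 3" "\<bar>y - y_out\<bar> < d / 3"
      using x by (auto simp: abc cube_def e_def)
    moreover have "dist (a_out, b_out, y_out) x \<le> \<bar>a - a_out\<bar> + dist (b_out, y_out) (b, y)"
      unfolding abc dist_Pair_Pair[of a_out] dist_real_def abs_minus_commute[of a]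
      by (rule sqrt_sum_squares_le_sum) auto
    moreover have "dist (b_out, y_out) (b, y) \<le> \<bar>b - b_out\<bar> + \<bar>y - y_out\<bar>"
      unfolding dist_Pair_Pair dist_real_def abs_minus_commute[of b] abs_minus_commute[of y]
      by (rule sqrt_sum_squares_le_sum) auto
    ultimately show "x \<in> ball (a_out, b_out, y_out) d" by simp
  qed
  then show ?thesis using d that[of e] by (auto simp: e_def)
qed

lemma continuous_on_angular_chart: "continuous_on UNIV (\<lambda>x. angular (chart x))"
proof -
  have chart: "chart = (\<lambda>x. (Complex (- 1) (fst x / sqrt 3), Complex (fst (snd x) / sqrt 3) (snd (snd x)),
      complex_of_real (2 * (snd (snd x) + fst x * fst (snd x) / 3))))"
    by (auto simp: chart_def)
  have dilate: "dilate r z = (complex_of_real r * fst z, complex_of_real (r ^ 2) * fst (snd z),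
      complex_of_real (r ^ 3) * snd (snd z))" for r z
    by (cases z) simp
  have phi: "phi z = root 6 (cmod (fst z) ^ 6 + cmod (fst (snd z)) ^ 3 + cmod (snd (snd z)) ^ 2)" for z
    by (cases z) simp
  have c: "continuous_on UNIV chart"
    unfolding chart Complex_eq by (intro continuous_intros) auto
  have "continuous_on UNIV (\<lambda>x. phi (chart x))"
    unfolding phi by (intro continuous_intros c)
  moreover have "phi (chart x) \<noteq> 0" for x
    using phi_pos[OF chart_neq_0, of x] by simp
  moreover define \<rho> where "\<rho> x = 1 / phi (chart x)" for x
  ultimately have "continuous_on UNIV \<rho>"
    unfolding \<rho>_def by (intro continuous_intros) auto
  then show ?thesis
    unfolding angular_eq[OF chart_neq_0] dilate \<rho>_def[symmetric] by (intro continuous_intros c)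
qed

lemma openin_Xi_W0_mod:
  "openin Xi_W0_mod U \<longleftrightarrow> (\<exists>W. openin Xi_W_mod W \<and> U = W \<inter> VT_orbit ` Xi_W0)"
  unfolding Xi_W0_mod_def by (rule openin_subtopology)

text \<open>Open sets pull back along the continuous map \<open>angular (chart x)\<close>, hence
  contain a cube around the base point. With \<open>openin_chart_orbit_cube\<close>, the cubes form
  a neighbourhood base at \<open>q_out\<close>.\<close>

lemma chart_orbit_neighbourhood:
  assumes U: "openin Xi_W0_mod U" and q: "q_out \<in> U"
  obtains e where "0 < e" "e \<le> 1/100" "chart_orbit ` cube e \<subseteq> U"
proof -
  obtain U' where U': "openin Xi_W_mod U'" "U = U' \<inter> VT_orbit ` Xi_W0"
    using U openin_Xi_W0_mod by blast
  obtain W where W: "open W" "{\<xi> \<in> Xi_W. VT_orbit \<xi> \<in> U'} = Xi_W \<inter> W"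
    using U'(1) by (auto simp: openin_Xi_W_mod openin_open)
  define S where "S = (\<lambda>x. angular (chart x)) -` W"
  have "open S"
    unfolding S_def by (rule open_vimage[OF W(1) continuous_on_angular_chart])
  have in_Xi: "angular (chart x) \<in> Xi_W0 \<and> angular (chart x) \<in> Xi_W" if "admissible x" for x
    using angular_chart_in_Xi_W0[OF that] by (simp add: Xi_W0_def)
  have adm0: "admissible (a_out, b_out, y_out)"
    using cube_admissible[OF base_in_cube, of "1/100"] by simp
  have "(a_out, b_out, y_out) \<in> S"
    using q W(2) U'(2) in_Xi[OF adm0] by (auto simp: S_def q_out_eq chart_orbit_def)
  then obtain e where e: "0 < e" "e \<le> 1/100" "cube e \<subseteq> S"
    using cube_neighbourhood[OF \<open>open S\<close>] by blast
  have "chart_orbit x \<in> U" if "x \<in> cube e" for x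
  proof -
    have "admissible x" using cube_admissible that e by blast
    moreover have "angular (chart x) \<in> W" using that e by (auto simp: S_def)
    ultimately have "angular (chart x) \<in> {\<xi> \<in> Xi_W. VT_orbit \<xi> \<in> U'}"
      unfolding W(2) using in_Xi by simp
    then show ?thesis
      using in_Xi[OF \<open>admissible x\<close>] U'(2) by (simp add: chart_orbit_def)
  qed
  then show ?thesis using e that by blast
qed

text \<open>
  The dilates of chart points in \<open>cube e\<close>, described by strict inequalities in the ambient
  space, with dilation factor \<open>- Re z1\<close> and denominators cleared.
\<close>

definition cell :: "real \<Rightarrow> complex3 set" where
  "cell e = {z. Re (fst z) < 0 \<and> Re (snd (snd z)) < 0 \<and>
     \<bar>sqrt 3 * Im (fst z) + a_out * Re (fst z)\<bar> < - e * Re (fst z) \<and>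
     \<bar>sqrt 3 * Re (fst (snd z)) - b_out * Re (fst z) ^ 2\<bar> < e * Re (fst z) ^ 2 \<and>
     \<bar>Im (fst (snd z)) - y_out * Re (fst z) ^ 2\<bar> < e * Re (fst z) ^ 2}"

lemma open_cell: "open (cell e)"
  unfolding cell_def
  by (intro open_Collect_conj open_Collect_less continuous_intros)

lemma dilate_chart_in_cell:
  assumes "x \<in> cube e" "admissible x" "r > 0"
  shows "dilate r (chart x) \<in> cell e"
proof -
  obtain a b y where x: "x = (a, b, y)" by (cases x)
  have scale: "\<bar>k * p - q * k\<bar> = k * \<bar>p - q\<bar>" if "k > 0" for k p q :: real
  proof -
    have "k * p - q * k = k * (p - q)" by (simp add: algebra_simps)
    then show ?thesis using that by (simp add: abs_mult)
  qed
  let ?z = "dilate r (chart x)"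
  have eqs: "Re (fst ?z) = - r" "sqrt 3 * Im (fst ?z) = r * a"
    "sqrt 3 * Re (fst (snd ?z)) = r\<^sup>2 * b" "Im (fst (snd ?z)) = r\<^sup>2 * y"
    "Re (snd (snd ?z)) = r ^ 3 * (2 * (y + a * b / 3))"
    unfolding x chart_def prod.case dilate.simps fst_conv snd_conv of_real_mult[symmetric]
    by simp_all
  have B: "\<bar>a - a_out\<bar> < e" "\<bar>b - b_out\<bar> < e" "\<bar>y - y_out\<bar> < e" "y + a * b / 3 < 0"
    using assms by (auto simp: x cube_def admissible_def)
  have "\<bar>r * a + a_out * - r\<bar> = r * \<bar>a - a_out\<bar>" "\<bar>r\<^sup>2 * b - b_out * (- r)\<^sup>2\<bar> = r\<^sup>2 * \<bar>b - b_out\<bar>"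
    "\<bar>r\<^sup>2 * y - y_out * (- r)\<^sup>2\<bar> = r\<^sup>2 * \<bar>y - y_out\<bar>"
    using assms(3) scale[of r a a_out] by (simp_all add: scale)
  note scaled = this
  show ?thesis
    unfolding cell_def mem_Collect_eq eqs scaled
    using B assms(3) by (intro conjI) (simp_all add: mult_pos_neg)
qed

text \<open>The dilation factor can only be \<open>- Re z1\<close>. The wall condition with
  \<open>Re z3 < 0\<close> makes z3 real, and the vanishing Hamiltonian fixes its value.\<close>

lemma cell_chart:
  assumes z: "z \<in> cell e" "snd (snd z) \<in> walls" "hamiltonian_vanishes z"
  obtains x r where "x \<in> cube e" "r > 0" "z = dilate r (chart x)"
proof -
  obtain z1 z2 z3 where zz: "z = (z1, z2, z3)" by (cases z)
  define r where "r = - Re z1"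
  define a b y where "a = sqrt 3 * Im z1 / r" and "b = sqrt 3 * Re z2 / r\<^sup>2" and "y = Im z2 / r\<^sup>2"
  have r: "r > 0" and z3: "Re z3 < 0" using z by (auto simp: cell_def zz r_def)
  have abc: "sqrt 3 * Im z1 = a * r" "sqrt 3 * Re z2 = b * r\<^sup>2" "Im z2 = y * r\<^sup>2"
    using r by (auto simp: a_def b_def y_def)
  have "\<bar>a * r - a_out * r\<bar> < e * r" "\<bar>b * r\<^sup>2 - b_out * r\<^sup>2\<bar> < e * r\<^sup>2" "\<bar>y * r\<^sup>2 - y_out * r\<^sup>2\<bar> < e * r\<^sup>2"
    using z(1) unfolding zz cell_def abc[symmetric] by (auto simp: r_def)
  then have "\<bar>a - a_out\<bar> * r < e * r" "\<bar>b - b_out\<bar> * r\<^sup>2 < e * r\<^sup>2" "\<bar>y - y_out\<bar> * r\<^sup>2 < e * r\<^sup>2"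
    using r by (simp_all add: abs_mult left_diff_distrib[symmetric])
  then have cube: "(a, b, y) \<in> cube e"
    using r by (simp add: cube_def)
  have z3r: "z3 = complex_of_real (Re z3)"
    using walls_Re_neg z z3 by (simp add: zz)
  have "hamiltonian_vanishes (z1, z2, complex_of_real (Re z3))"
    using z z3r by (simp add: zz)
  then have h: "Re z3 = - 2 * Im (cnj z1 * z2)"
    using hamiltonian_vanishes_iff[of "Re z3" z1 z2] z3 by simp
  have "3 * (Im z1 * Re z2) = (sqrt 3 * Im z1) * (sqrt 3 * Re z2)"
    by simp
  then have "Im z1 * Re z2 = r ^ 3 * (a * b / 3)"
    unfolding abc by (simp add: power2_eq_square power3_eq_cube mult_ac)
  moreover have "Re z1 * Im z2 = - (r ^ 3 * y)"
    using r_def abc(3) by (simp add: power2_eq_square power3_eq_cube)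
  ultimately have "Re z3 = r ^ 3 * (2 * (y + a * b / 3))"
    unfolding h by (simp add: algebra_simps)
  then have c3: "z3 = complex_of_real (r ^ 3) * complex_of_real (2 * (y + a * b / 3))"
    unfolding of_real_mult[symmetric] using z3r by simp
  have "z = dilate r (chart (a, b, y))"
    unfolding zz chart_def prod.case dilate.simps prod.inject c3
  proof (intro conjI complex_eqI)
    show "Re z1 = Re (complex_of_real r * Complex (- 1) (a / sqrt 3))" by (simp add: r_def)
    show "Im z1 = Im (complex_of_real r * Complex (- 1) (a / sqrt 3))"
      using abc(1) by (simp add: field_simps)
    show "Re z2 = Re (complex_of_real (r\<^sup>2) * Complex (b / sqrt 3) y)"
      using abc(2) by (simp add: field_simps flip: of_real_power)
    show "Im z2 = Im (complex_of_real (r\<^sup>2) * Complex (b / sqrt 3) y)"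
      using abc(3) by (simp add: field_simps flip: of_real_power)
  qed simp_all
  then show ?thesis using that cube r by blast
qed

lemma continuous_on_act: "continuous_on UNIV (act v)"
proof -
  have eq: "act v = (\<lambda>z. (v * fst z, v * fst (snd z), v * snd (snd z)))" by auto
  show ?thesis by (subst eq) (intro continuous_intros)
qed

text \<open>The union of the rotated cells is open and invariant under \<open>V_T\<close>, so it
  defines an open set of the quotient; on the zero set of the Hamiltonian its points are exactly the
  chart orbits of the cube.\<close>

lemma openin_chart_orbit_cube:
  assumes e: "e \<le> 1/100"
  shows "openin Xi_W0_mod (chart_orbit ` cube e)"
proof -
  define W where "W = (\<Union>v\<in>V_T. act v -` cell e)"
  define U where "U = VT_orbit ` (Xi_W \<inter> W)"
  have "open W"
    unfolding W_def using open_vimage[OF open_cell continuous_on_act] by auto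
  have W_act: "act v \<xi> \<in> W" if v: "v \<in> V_T" and \<xi>: "\<xi> \<in> W" for v \<xi>
  proof -
    obtain w where w: "w \<in> V_T" "act w \<xi> \<in> cell e" using \<xi> unfolding W_def by blast
    have "act (w * cnj v) (act v \<xi>) = act w \<xi>"
      using V_T_cnj_mult[OF v] by (simp add: act_act mult.assoc)
    then show ?thesis
      using w V_T_mult[OF w(1) V_T_cnj[OF v]] unfolding W_def UN_iff vimage_eq by metis
  qed
  have "{\<xi> \<in> Xi_W. VT_orbit \<xi> \<in> U} = Xi_W \<inter> W"
    using W_act by (auto simp: U_def VT_orbit_eq_iff)
  then have "openin Xi_W_mod U"
    using \<open>open W\<close> by (auto simp: openin_Xi_W_mod U_def openin_open)
  moreover have "chart_orbit ` cube e = U \<inter> VT_orbit ` Xi_W0"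
  proof (intro equalityI subsetI)
    fix Q assume "Q \<in> chart_orbit ` cube e"
    then obtain x where x: "x \<in> cube e" "Q = chart_orbit x" by auto
    have adm: "admissible x" using cube_admissible x e by blast
    have "angular (chart x) \<in> cell e"
      unfolding angular_eq[OF chart_neq_0]
      using dilate_chart_in_cell[OF x(1) adm] phi_pos[OF chart_neq_0] by simp
    then have "angular (chart x) \<in> W"
      using V_T_elements(1) unfolding W_def by (auto intro!: bexI[of _ 1])
    then show "Q \<in> U \<inter> VT_orbit ` Xi_W0"
      using angular_chart_in_Xi_W0[OF adm] by (auto simp: x chart_orbit_def U_def Xi_W0_def)
  next
    fix Q assume Q: "Q \<in> U \<inter> VT_orbit ` Xi_W0"
    then obtain \<eta> where \<eta>: "\<eta> \<in> Xi_W0" "Q = VT_orbit \<eta>" by auto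
    obtain \<xi> v where \<xi>: "Q = VT_orbit \<xi>" "v \<in> V_T" "act v \<xi> \<in> cell e"
      using Q by (auto simp: U_def W_def)
    define z where "z = act v \<xi>"
    have Qz: "Q = VT_orbit z"
      using \<xi> by (simp add: z_def VT_orbit_act)
    then obtain w where "w \<in> V_T" "z = act w \<eta>"
      using \<eta> VT_orbit_eq_iff by metis
    then have z: "z \<in> Xi_W0" using Xi_W0_act \<eta> by simp
    then obtain x r where x: "x \<in> cube e" "r > 0" "z = dilate r (chart x)"
      using cell_chart[of z e] \<xi>(3) unfolding Xi_W0_def Xi_W_def z_def by blast
    have "phi z = 1" using z by (simp add: Xi_W0_def Xi_W_def Xi_def)
    moreover have z0: "z \<noteq> 0" unfolding x using x chart_neq_0 dilate_neq_0 by simp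
    ultimately have "angular z = z" by (simp add: angular_eq)
    then have "z = angular (chart x)" using x by (simp add: angular_dilate chart_neq_0)
    then show "Q \<in> chart_orbit ` cube e" using x Qz by (auto simp: chart_orbit_def)
  qed
  ultimately show ?thesis using openin_Xi_W0_mod by blast
qed

section \<open>The involution as a homeomorphism of the quotient\<close>

lemma walls_cnj: "w \<in> walls \<Longrightarrow> cnj w \<in> walls"
  using V_T_cnj unfolding walls_def by force

lemma hamiltonian_vanishes_tau: "hamiltonian_vanishes z \<Longrightarrow> hamiltonian_vanishes (tau z)"
proof (cases z)
  case (fields z1 z2 z3)
  assume z: "hamiltonian_vanishes z"
  have "H_F (tau z) (cnj u) = H_F z u" for u
    unfolding fields by (simp add: ReIP_def)
  then have "H_F (tau z) ` cnj ` V_T = H_F z ` V_T"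
    by (simp add: image_image)
  then show ?thesis using z by (simp add: hamiltonian_vanishes_def cnj_V_T_image)
qed

lemma Xi_W_tau: "\<xi> \<in> Xi_W \<Longrightarrow> tau \<xi> \<in> Xi_W"
  using walls_cnj phi_tau by (cases \<xi>) (auto simp: Xi_W_def Xi_def simp del: phi.simps)

lemma Xi_W0_tau: "\<xi> \<in> Xi_W0 \<Longrightarrow> tau \<xi> \<in> Xi_W0"
  using Xi_W_tau hamiltonian_vanishes_tau by (auto simp: Xi_W0_def)

lemma tau_image_tau_image: "tau ` tau ` Q = Q"
  by (simp add: image_image)

lemma continuous_on_tau: "continuous_on UNIV tau"
proof -
  have eq: "tau = (\<lambda>z. (cnj (fst z), - cnj (fst (snd z)), cnj (snd (snd z))))" by auto
  show ?thesis by (subst eq) (intro continuous_intros)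
qed

lemma openin_tau_image:
  assumes "openin Xi_W0_mod U"
  shows "openin Xi_W0_mod ((`) tau ` U)"
proof -
  obtain U' where U': "openin Xi_W_mod U'" "U = U' \<inter> VT_orbit ` Xi_W0"
    using assms openin_Xi_W0_mod by blast
  obtain W where W: "open W" "{\<xi> \<in> Xi_W. VT_orbit \<xi> \<in> U'} = Xi_W \<inter> W"
    using U'(1) by (auto simp: openin_Xi_W_mod openin_open)
  \<comment> \<open>As \<open>tau\<close> is an involution, images under it are preimages, and
    openness follows from continuity.\<close>
  have mem: "Q \<in> (`) tau ` A \<longleftrightarrow> tau ` Q \<in> A" for Q and A :: "complex3 set set"
    using image_eqI[of Q "(`) tau" "tau ` Q" A] by (auto simp: tau_image_tau_image)
  have orb: "tau ` Q \<in> VT_orbit ` A" if "Q \<in> VT_orbit ` A" "\<And>\<xi>. \<xi> \<in> A \<Longrightarrow> tau \<xi> \<in> A" for Q and A :: "complex3 set"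
    using that by (auto simp: tau_VT_orbit)
  have W': "VT_orbit (tau \<xi>) \<in> U' \<longleftrightarrow> tau \<xi> \<in> W" if "\<xi> \<in> Xi_W" for \<xi>
    using W(2) Xi_W_tau[OF that] by blast
  have "{\<xi> \<in> Xi_W. VT_orbit \<xi> \<in> (`) tau ` U'} = Xi_W \<inter> tau -` W"
    using W' unfolding mem tau_VT_orbit vimage_def by blast
  moreover have "open (tau -` W)"
    by (rule open_vimage[OF W(1) continuous_on_tau])
  moreover have "(`) tau ` U' \<subseteq> VT_orbit ` Xi_W"
    using U'(1) orb[OF _ Xi_W_tau] by (auto simp: openin_Xi_W_mod)
  ultimately have "openin Xi_W_mod ((`) tau ` U')"
    by (auto simp: openin_Xi_W_mod openin_open)
  moreover have "(`) tau ` U = (`) tau ` U' \<inter> VT_orbit ` Xi_W0"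
  proof (intro set_eqI)
    fix Q
    have "tau ` Q \<in> VT_orbit ` Xi_W0 \<longleftrightarrow> Q \<in> VT_orbit ` Xi_W0"
      using orb[OF _ Xi_W0_tau, of Q] orb[OF _ Xi_W0_tau, of "tau ` Q"]
      by (auto simp only: tau_image_tau_image)
    then show "Q \<in> (`) tau ` U \<longleftrightarrow> Q \<in> (`) tau ` U' \<inter> VT_orbit ` Xi_W0"
      unfolding U'(2) mem Int_iff by blast
  qed
  ultimately show ?thesis using openin_Xi_W0_mod by blast
qed

section \<open>Iterates of the angular map, fixed points and stability\<close>

lemma divide_power2_le:
  fixes e :: real
  assumes "0 \<le> e"
  shows "e / 2 ^ n \<le> e"
  using assms mult_left_mono[of 1 "2 ^ n" e] by (simp add: pos_divide_le_eq)

lemma F_ang_funpow_cube: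
  assumes "e \<le> 1/100" "0 < e" "Q \<in> chart_orbit ` cube e"
  shows "(F_ang ^^ n) Q \<in> chart_orbit ` cube (e / 2 ^ n)"
proof (induction n)
  case 0
  then show ?case using assms by simp
next
  case (Suc n)
  then obtain x where x: "x \<in> cube (e / 2 ^ n)" "(F_ang ^^ n) Q = chart_orbit x" by blast
  have "e / 2 ^ n \<le> 1/100" using assms divide_power2_le[of e n] by linarith
  then obtain x' where x': "x' \<in> cube (e / 2 ^ n / 2)" "F_ang (chart_orbit x) = chart_orbit x'"
    by (rule F_ang_step[OF x(1)])
  have "e / 2 ^ n / 2 = e / 2 ^ Suc n" by simp
  moreover have "(F_ang ^^ Suc n) Q = chart_orbit x'" using x(2) x'(2) by simp
  ultimately show ?case using x'(1) by (metis imageI)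
qed

text \<open>This produces points ever closer to \<open>q_in\<close> that are carried to one
  prescribed point.\<close>

lemma F_ang_funpow_tau:
  assumes "e \<le> 1/100" "0 < e" "x \<in> cube e"
  shows "\<exists>x'\<in>cube (e / 2 ^ n). (F_ang ^^ n) (tau ` chart_orbit x') = tau ` chart_orbit x"
proof (induction n)
  case 0
  then show ?case using assms(3) by (intro bexI[of _ x]) simp_all
next
  case (Suc n)
  then obtain x' where x': "x' \<in> cube (e / 2 ^ n)"
    "(F_ang ^^ n) (tau ` chart_orbit x') = tau ` chart_orbit x" by blast
  have "e / 2 ^ n \<le> 1/100" using assms divide_power2_le[of e n] by linarith
  then obtain x'' where x'': "x'' \<in> cube (e / 2 ^ n / 2)"
    "F_ang (tau ` chart_orbit x'') = tau ` chart_orbit x'"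
    by (rule F_ang_step[OF x'(1)])
  have "e / 2 ^ n / 2 = e / 2 ^ Suc n" by simp
  moreover have "(F_ang ^^ Suc n) (tau ` chart_orbit x'') = tau ` chart_orbit x"
    \<comment> \<open>The new step comes first in time, so the iterate is unfolded at its inner
      end.\<close>
    unfolding funpow_Suc_right o_apply x''(2) by (rule x'(2))
  ultimately show ?case using x''(1) by metis
qed

lemma topspace_Xi_W0_mod: "topspace Xi_W0_mod = VT_orbit ` Xi_W0"
  by (auto simp: Xi_W0_mod_def topspace_Xi_W_mod Xi_W0_def)

text \<open>The contraction step applies to the base point in every small cube; by injectivity of
  the chart all resulting images are the same point, which lies in every cube and so is the base
  point. The reversed equation of the step then fixes \<open>q_in\<close>.\<close>

lemma F_ang_fixed_points: "F_ang q_out = q_out" "F_ang q_in = q_in"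
proof -
  let ?x0 = "(a_out, b_out, y_out)"
  have x0: "?x0 \<in> cube (1/100)" by (simp add: base_in_cube)
  obtain x where x: "x \<in> cube (1/100 / 2)" "F_ang (chart_orbit ?x0) = chart_orbit x"
    "F_ang (tau ` chart_orbit x) = tau ` chart_orbit ?x0"
    by (rule F_ang_step[OF x0 order_refl])
  have small: "x \<in> cube e" if "0 < e" for e
  proof -
    define d where "d = min e (1/100)"
    have d: "0 < d" "d \<le> 1/100" "d / 2 \<le> e" using that by (auto simp: d_def)
    obtain x' where x': "x' \<in> cube (d / 2)" "F_ang (chart_orbit ?x0) = chart_orbit x'"
      by (rule F_ang_step[OF base_in_cube[OF d(1)] d(2)])
    have "admissible x'"
      using d by (intro cube_admissible[OF x'(1)]) simp
    then have "x = x'"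
      using x(2) x'(2) by (intro chart_orbit_inj) simp_all
    then show ?thesis using x'(1) cube_mono[OF d(3)] by blast
  qed
  have zero: "p = 0" if "\<And>e. 0 < e \<Longrightarrow> \<bar>p\<bar> < e" for p :: real
    using that[of "\<bar>p\<bar>"] by (cases "p = 0") simp_all
  obtain a b y where abc: "x = (a, b, y)" by (cases x)
  have D: "\<bar>a - a_out\<bar> < e" "\<bar>b - b_out\<bar> < e" "\<bar>y - y_out\<bar> < e" if "0 < e" for e
    using small[OF that] by (simp_all add: abc cube_def)
  have x0: "x = ?x0"
    using zero[OF D(1)] zero[OF D(2)] zero[OF D(3)] by (simp add: abc)
  show "F_ang q_out = q_out"
    using x(2) unfolding x0 q_out_eq .
  show "F_ang q_in = q_in"
    using x(3) unfolding x0 q_out_eq q_in_def .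
qed

lemma equilibria: "equilibrium Xi_W0_mod F_ang q_out" "equilibrium Xi_W0_mod F_ang q_in"
proof -
  have "admissible (a_out, b_out, y_out)"
    using cube_admissible[OF base_in_cube, of "1/100"] by simp
  then have "angular (chart (a_out, b_out, y_out)) \<in> Xi_W0"
    by (rule angular_chart_in_Xi_W0)
  from imageI[OF this, of VT_orbit] imageI[OF Xi_W0_tau[OF this], of VT_orbit]
  have "q_out \<in> VT_orbit ` Xi_W0" "q_in \<in> VT_orbit ` Xi_W0"
    unfolding q_in_def q_out_eq chart_orbit_def tau_VT_orbit .
  then show "equilibrium Xi_W0_mod F_ang q_out" "equilibrium Xi_W0_mod F_ang q_in"
    unfolding equilibrium_def topspace_Xi_W0_mod by (simp_all only: F_ang_fixed_points simp_thms)
qed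

lemma stable_q_out: "stable_equilibrium Xi_W0_mod F_ang q_out"
  unfolding stable_equilibrium_def
proof (intro conjI allI impI)
  show "equilibrium Xi_W0_mod F_ang q_out" by (rule equilibria)
  fix U assume U: "openin Xi_W0_mod U \<and> q_out \<in> U"
  obtain e where e: "0 < e" "e \<le> 1/100" "chart_orbit ` cube e \<subseteq> U"
    by (rule chart_orbit_neighbourhood[OF conjunct1[OF U] conjunct2[OF U]])
  have "(F_ang ^^ n) Q \<in> U" if Q: "Q \<in> chart_orbit ` cube e" for Q n
  proof -
    have "chart_orbit ` cube (e / 2 ^ n) \<subseteq> chart_orbit ` cube e"
      using e(1) by (intro image_mono cube_mono divide_power2_le) simp
    with F_ang_funpow_cube[OF e(2,1) Q, of n] e(3) show ?thesis by blast
  qed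
  moreover have "openin Xi_W0_mod (chart_orbit ` cube e)" "q_out \<in> chart_orbit ` cube e"
    using e by (auto intro: openin_chart_orbit_cube q_out_in_cube)
  ultimately show "\<exists>V. openin Xi_W0_mod V \<and> q_out \<in> V \<and> (\<forall>x\<in>V. \<forall>n. (F_ang ^^ n) x \<in> U)"
    by (intro exI[of _ "chart_orbit ` cube e"] conjI ballI allI)
qed

lemma eventually_div_power_le:
  fixes e d :: real
  assumes "0 < d"
  shows "\<forall>\<^sub>F n in sequentially. e / 2 ^ n \<le> d"
proof -
  have "(\<lambda>n. e / 2 ^ n) \<longlonglongrightarrow> 0"
    using tendsto_mult_right_zero[OF LIMSEQ_power_zero[of "1/2 :: real"], of e]
    by (simp add: power_divide)
  from order_tendstoD(2)[OF this assms] show ?thesis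
    by (rule eventually_mono) simp
qed

lemma asymptotically_stable_q_out: "asymptotically_stable_equilibrium Xi_W0_mod F_ang q_out"
proof -
  let ?V = "chart_orbit ` cube (1/100)"
  have "limitin Xi_W0_mod (\<lambda>n. (F_ang ^^ n) Q) q_out sequentially" if Q: "Q \<in> ?V" for Q
    unfolding limitin_def
  proof (intro conjI allI impI)
    show "q_out \<in> topspace Xi_W0_mod" using equilibria by (simp add: equilibrium_def)
    fix U assume U: "openin Xi_W0_mod U \<and> q_out \<in> U"
    obtain e where e: "0 < e" "e \<le> 1/100" "chart_orbit ` cube e \<subseteq> U"
      by (rule chart_orbit_neighbourhood[OF conjunct1[OF U] conjunct2[OF U]])
    show "\<forall>\<^sub>F n in sequentially. (F_ang ^^ n) Q \<in> U"
      using eventually_div_power_le[OF e(1), of "1/100"]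
    proof (rule eventually_mono)
      fix n :: nat assume n: "1/100 / 2 ^ n \<le> e"
      have "(F_ang ^^ n) Q \<in> chart_orbit ` cube (1/100 / 2 ^ n)"
        using Q by (intro F_ang_funpow_cube) simp_all
      then show "(F_ang ^^ n) Q \<in> U"
        using cube_mono[OF n] e(3) by blast
    qed
  qed
  moreover have "openin Xi_W0_mod ?V" by (intro openin_chart_orbit_cube order_refl)
  moreover have "q_out \<in> ?V" by (intro q_out_in_cube) simp
  ultimately show ?thesis
    unfolding asymptotically_stable_equilibrium_def using stable_q_out by blast
qed

lemma unstable_q_in: "unstable_equilibrium Xi_W0_mod F_ang q_in"
  unfolding unstable_equilibrium_def
proof (intro conjI equilibria notI)
  assume stable: "stable_equilibrium Xi_W0_mod F_ang q_in"
  \<comment> \<open>A point on the boundary of the smaller cube: inside the region of contraction,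
    but outside the target neighbourhood.\<close>
  define x1 where "x1 = (a_out + 1/200, b_out, y_out)"
  have x1: "x1 \<in> cube (1/100)" "x1 \<notin> cube (1/200)" by (auto simp: x1_def cube_def)
  define U where "U = (`) tau ` chart_orbit ` cube (1/200)"
  have U: "openin Xi_W0_mod U"
    unfolding U_def by (intro openin_tau_image openin_chart_orbit_cube) simp
  have "q_in \<in> U"
    unfolding U_def q_in_def by (intro imageI q_out_in_cube) simp
  with U stable have "\<exists>V. openin Xi_W0_mod V \<and> q_in \<in> V \<and> (\<forall>Q\<in>V. \<forall>n. (F_ang ^^ n) Q \<in> U)"
    unfolding stable_equilibrium_def by simp
  then obtain V where V: "openin Xi_W0_mod V" "q_in \<in> V" "\<forall>Q\<in>V. \<forall>n. (F_ang ^^ n) Q \<in> U"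
    by (elim exE conjE)
  \<comment> \<open>Reflecting \<open>V\<close> gives a neighbourhood of \<open>q_out\<close>, in
    which the points from \<open>F_ang_funpow_tau\<close> can be found.\<close>
  have "q_out \<in> (`) tau ` V"
    using imageI[OF V(2), of "(`) tau"] by (simp only: q_in_def tau_image_tau_image)
  then obtain e where e: "0 < e" "chart_orbit ` cube e \<subseteq> (`) tau ` V"
    by (rule chart_orbit_neighbourhood[OF openin_tau_image[OF V(1)]])
  obtain n :: nat where n: "1/100 / 2 ^ n \<le> e"
    using eventually_happens'[OF sequentially_bot eventually_div_power_le[OF e(1), of "1/100"]] by blast
  obtain x where x: "x \<in> cube (1/100 / 2 ^ n)" "(F_ang ^^ n) (tau ` chart_orbit x) = tau ` chart_orbit x1"
    using F_ang_funpow_tau[OF order_refl _ x1(1), of n] by auto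
  have "x \<in> cube e" using x(1) cube_mono[OF n] by (rule subsetD[rotated])
  then have "chart_orbit x \<in> (`) tau ` V" using e(2) by blast
  then obtain Q where "Q \<in> V" "chart_orbit x = tau ` Q" by (elim imageE)
  then have "tau ` chart_orbit x \<in> V" by (simp only: tau_image_tau_image)
  then have "tau ` chart_orbit x1 \<in> U" using V(3) unfolding x(2)[symmetric] by simp
  then obtain x' where x': "x' \<in> cube (1/200)" "tau ` chart_orbit x1 = tau ` chart_orbit x'"
    unfolding U_def by (elim imageE) simp
  have "chart_orbit x1 = tau ` tau ` chart_orbit x1"
    by (rule tau_image_tau_image[symmetric])
  also have "\<dots> = chart_orbit x'"
    unfolding x'(2) by (rule tau_image_tau_image)
  finally have "chart_orbit x1 = chart_orbit x'" .
  then have "x1 = x'"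
    by (rule chart_orbit_inj) (rule cube_admissible[OF x'(1)], simp)
  then show False using x'(1) x1(2) by simp
qed

theorem lemma13p5p5:
  shows "asymptotically_stable_equilibrium Xi_W0_mod F_ang q_out
       \<and> unstable_equilibrium Xi_W0_mod F_ang q_in"
  using asymptotically_stable_q_out unstable_q_in by blast

end
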